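(* Let $M$ be a smooth manifold of dimension $n\ge 3$ and let $F=\alpha\phi(s)$, $s=\beta/\alpha$, be an $(\alpha,\beta)$-metric on $M$ with $\beta$ nowhere zero. Then $F$ satisfies the $T$-condition (i.e. $T_{hijk}=0$ on $\mathcal D^*$) if and only if either $F$ is Riemannian (i.e. $g_{ij}$ does not depend on $y$), or $\phi$ is given by $$\phi(s)=c_3\,s^{\frac{cb^2-1}{cb^2}}\,(cb^2-cs^2)^{\frac{1}{2cb^2}}$$ for some constants $c\neq 0$ and $c_3$, where $b^2=a^{ij}b_ib_j$ (the formula being understood, at each $x\in M$, with $b=b(x)$ and for all values of $s$ attained on $\mathcal D^*\cap T_xM$).
   Context: $(\alpha,\beta)$-metrics. $M$ is an $n$-dimensional smooth manifold with induced local coordinates $(x^i,y^i)$ on $TM$; $\alpha=\sqrt{a_{ij}(x)y^iy^j}$ is the norm of a Riemannian metric, $\beta=b_i(x)y^i$ a 1-form. $(a^{ij})$ is the inverse of $(a_{ij})$, $b^i:=a^{ij}b_j$, $b^2:=b^ib_i$ (a function of $x$). Let $b_0>0$, let $J=(-b_0,b_0)$ or $J=(0,b_0)$, let $\phi:J\to\mathbb R$ be smooth, and assume $b(x)\le b_0$ for all $x$. $F:=\alpha\,\phi(s)$ with $s:=\beta/\alpha$, defined on the open set $\mathcal D$ of nonzero tangent vectors with $s\in J$. It is assumed that $\phi(t)>0$ and $\phi(t)-t\phi'(t)+(x^2-t^2)\phi''(t)>0$ for $t\in J$, $|t|<x<b_0$, and that $g_{ij}:=\frac12\frac{\partial^2F^2}{\partial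 y^i\partial y^j}$ is nondegenerate on $\mathcal D$, i.e. $\phi-s\phi'\ne0$ and $\phi-s\phi'+(b^2-s^2)\phi''\neq 0$ there. Primes denote derivatives in $s$. Put $\alpha_i:=\partial\alpha/\partial y^i$, $m_i:=b_i-s\alpha_i$, $m^2:=b^2-s^2=a^{ij}m_im_j$, and let $\mathcal D^*\subset\mathcal D$ be the set of points where $m_i\ne 0$ (equivalently $m^2\neq0$). $T$-tensor: with $\dot\partial_i=\partial/\partial y^i$, $C_{ijk}=\frac12\dot\partial_kg_{ij}$, $C^s_{ij}=g^{sr}C_{rij}$, $C_{rijk}=\dot\partial_rC_{ijk}$, $\ell_i=\dot\partial_iF$, $$T_{rijk}=FC_{rijk}-F(C_{sij}C^s_{rk}+C_{sjr}C^s_{ik}+C_{sir}C^s_{jk})+C_{rij}\ell_k+C_{rik}\ell_j+C_{rjk}\ell_i+C_{ijk}\ell_r .$$ Real powers are taken of positive bases; in particular the displayed formula for $\phi$ is considered for $s>0$. *)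

theory Defs
  imports "HOL-Analysis.Analysis"
begin

text \<open>Smoothness of a map on an open set S of a normed space: all iterated directional
  derivatives exist and are continuous. Both definitions are meant for open S only.\<close>

fun Ck_on :: "nat \<Rightarrow> 'a::real_normed_vector set \<Rightarrow> ('a \<Rightarrow> 'b::real_normed_vector) \<Rightarrow> bool" where
  "Ck_on 0 S f = continuous_on S f"
| "Ck_on (Suc k) S f =
     (f differentiable_on S \<and> (\<forall>v. Ck_on k S (\<lambda>x. frechet_derivative f (at x) v)))"

definition smooth_on :: "'a::real_normed_vector set \<Rightarrow> ('a \<Rightarrow> 'b::real_normed_vector) \<Rightarrow> bool" where
  "smooth_on S f \<longleftrightarrow> (\<forall>k. Ck_on k S f)"


text \<open>A chart is a pair of its domain and its coordinate map. The manifold is the whole type 'm,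
  which is Hausdorff and second countable by its sort; its dimension is CARD('n).\<close>

type_synonym ('m, 'n) chart = "'m set \<times> ('m \<Rightarrow> real ^ 'n)"

definition chart_inv :: "('m, 'n) chart \<Rightarrow> real ^ 'n \<Rightarrow> 'm" where
  "chart_inv \<kappa> = inv_into (fst \<kappa>) (snd \<kappa>)"

definition transition :: "('m, 'n) chart \<Rightarrow> ('m, 'n) chart \<Rightarrow> real ^ 'n \<Rightarrow> real ^ 'n" where
  "transition \<kappa> \<kappa>' = snd \<kappa>' \<circ> chart_inv \<kappa>"

definition smooth_atlas ::
    "('m::{t2_space, second_countable_topology}, 'n::finite) chart set \<Rightarrow> bool" where
  "smooth_atlas \<A> \<longleftrightarrow>
     (\<Union>\<kappa>\<in>\<A>. fst \<kappa>) = UNIV \<and>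
     (\<forall>\<kappa>\<in>\<A>. open (fst \<kappa>) \<and> open (snd \<kappa> ` fst \<kappa>) \<and>
        homeomorphism (fst \<kappa>) (snd \<kappa> ` fst \<kappa>) (snd \<kappa>) (chart_inv \<kappa>)) \<and>
     (\<forall>\<kappa>\<in>\<A>. \<forall>\<kappa>'\<in>\<A>. smooth_on (snd \<kappa> ` (fst \<kappa> \<inter> fst \<kappa>')) (transition \<kappa> \<kappa>'))"

text \<open>The entry in row k and column i is the partial derivative, at p, of the k-th coordinate
  of the second chart with respect to the i-th coordinate of the first one.\<close>

definition jacobian :: "('m, 'n::finite) chart \<Rightarrow> ('m, 'n) chart \<Rightarrow> 'm \<Rightarrow> real ^ 'n ^ 'n" where
  "jacobian \<kappa> \<kappa>' p = matrix (frechet_derivative (transition \<kappa> \<kappa>') (at (snd \<kappa> p)))"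

text \<open>Tensor fields are given by their components in every chart of the atlas, subject to the
  transformation law.\<close>

definition riemannian_metric ::
    "('m, 'n::finite) chart set \<Rightarrow> (('m, 'n) chart \<Rightarrow> 'm \<Rightarrow> real ^ 'n ^ 'n) \<Rightarrow> bool" where
  "riemannian_metric \<A> a \<longleftrightarrow>
     (\<forall>\<kappa>\<in>\<A>. \<forall>i j. smooth_on (snd \<kappa> ` fst \<kappa>) (\<lambda>u. a \<kappa> (chart_inv \<kappa> u) $ i $ j)) \<and>
     (\<forall>\<kappa>\<in>\<A>. \<forall>p\<in>fst \<kappa>. (\<forall>i j. a \<kappa> p $ i $ j = a \<kappa> p $ j $ i) \<and>
        (\<forall>v. v \<noteq> 0 \<longrightarrow> (\<Sum>i\<in>UNIV. \<Sum>j\<in>UNIV. a \<kappa> p $ i $ j * v $ i * v $ j) > 0)) \<and>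
     (\<forall>\<kappa>\<in>\<A>. \<forall>\<kappa>'\<in>\<A>. \<forall>p\<in>fst \<kappa> \<inter> fst \<kappa>'. \<forall>i j.
        a \<kappa> p $ i $ j = (\<Sum>k\<in>UNIV. \<Sum>l\<in>UNIV.
          jacobian \<kappa> \<kappa>' p $ k $ i * jacobian \<kappa> \<kappa>' p $ l $ j * a \<kappa>' p $ k $ l))"

definition one_form ::
    "('m, 'n::finite) chart set \<Rightarrow> (('m, 'n) chart \<Rightarrow> 'm \<Rightarrow> real ^ 'n) \<Rightarrow> bool" where
  "one_form \<A> b \<longleftrightarrow>
     (\<forall>\<kappa>\<in>\<A>. \<forall>i. smooth_on (snd \<kappa> ` fst \<kappa>) (\<lambda>u. b \<kappa> (chart_inv \<kappa> u) $ i)) \<and>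
     (\<forall>\<kappa>\<in>\<A>. \<forall>\<kappa>'\<in>\<A>. \<forall>p\<in>fst \<kappa> \<inter> fst \<kappa>'. \<forall>i.
        b \<kappa> p $ i = (\<Sum>k\<in>UNIV. jacobian \<kappa> \<kappa>' p $ k $ i * b \<kappa>' p $ k))"


text \<open>From here on everything takes place in one tangent space, in the linear coordinates y
  induced by a chart. All derivatives are with respect to y.\<close>

definition partial :: "'n::finite \<Rightarrow> (real ^ 'n \<Rightarrow> real) \<Rightarrow> real ^ 'n \<Rightarrow> real" where
  "partial i f y = deriv (\<lambda>t. f (y + t *\<^sub>R axis i 1)) 0"

definition fund :: "(real ^ 'n::finite \<Rightarrow> real) \<Rightarrow> 'n \<Rightarrow> 'n \<Rightarrow> real ^ 'n \<Rightarrow> real" where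
  "fund F i j y = 1/2 * partial i (partial j (\<lambda>z. (F z)\<^sup>2)) y"

definition fund_mat :: "(real ^ 'n::finite \<Rightarrow> real) \<Rightarrow> real ^ 'n \<Rightarrow> real ^ 'n ^ 'n" where
  "fund_mat F y = (\<chi> i j. fund F i j y)"

definition cartan :: "(real ^ 'n::finite \<Rightarrow> real) \<Rightarrow> 'n \<Rightarrow> 'n \<Rightarrow> 'n \<Rightarrow> real ^ 'n \<Rightarrow> real" where
  "cartan F i j k y = 1/2 * partial k (fund F i j) y"

text \<open>The first index is the raised one.\<close>

definition cartan_up :: "(real ^ 'n::finite \<Rightarrow> real) \<Rightarrow> 'n \<Rightarrow> 'n \<Rightarrow> 'n \<Rightarrow> real ^ 'n \<Rightarrow> real" where
  "cartan_up F s i j y = (\<Sum>r\<in>UNIV. matrix_inv (fund_mat F y) $ s $ r * cartan F r i j y)"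

definition cartan_dot ::
    "(real ^ 'n::finite \<Rightarrow> real) \<Rightarrow> 'n \<Rightarrow> 'n \<Rightarrow> 'n \<Rightarrow> 'n \<Rightarrow> real ^ 'n \<Rightarrow> real" where
  "cartan_dot F r i j k y = partial r (cartan F i j k) y"

definition T_tensor ::
    "(real ^ 'n::finite \<Rightarrow> real) \<Rightarrow> 'n \<Rightarrow> 'n \<Rightarrow> 'n \<Rightarrow> 'n \<Rightarrow> real ^ 'n \<Rightarrow> real" where
  "T_tensor F r i j k y =
     F y * cartan_dot F r i j k y
     - F y * (\<Sum>s\<in>UNIV. cartan F s i j y * cartan_up F s r k y
                      + cartan F s j r y * cartan_up F s i k y
                      + cartan F s i r y * cartan_up F s j k y)
     + cartan F r i j y * partial k F y + cartan F r i k y * partial j F y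
     + cartan F r j k y * partial i F y + cartan F i j k y * partial r F y"


definition alpha :: "real ^ 'n ^ 'n \<Rightarrow> real ^ 'n::finite \<Rightarrow> real" where
  "alpha a y = sqrt (\<Sum>i\<in>UNIV. \<Sum>j\<in>UNIV. a $ i $ j * y $ i * y $ j)"

definition beta :: "real ^ 'n \<Rightarrow> real ^ 'n::finite \<Rightarrow> real" where
  "beta b y = (\<Sum>i\<in>UNIV. b $ i * y $ i)"

definition ab_s :: "real ^ 'n ^ 'n \<Rightarrow> real ^ 'n \<Rightarrow> real ^ 'n::finite \<Rightarrow> real" where
  "ab_s a b y = beta b y / alpha a y"

definition bsq :: "real ^ 'n ^ 'n \<Rightarrow> real ^ 'n::finite \<Rightarrow> real" where
  "bsq a b = (\<Sum>i\<in>UNIV. \<Sum>j\<in>UNIV. matrix_inv a $ i $ j * b $ i * b $ j)"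

definition ab_F ::
    "(real \<Rightarrow> real) \<Rightarrow> real ^ 'n ^ 'n \<Rightarrow> real ^ 'n \<Rightarrow> real ^ 'n::finite \<Rightarrow> real" where
  "ab_F \<phi> a b y = alpha a y * \<phi> (ab_s a b y)"

definition ab_dom :: "real set \<Rightarrow> real ^ 'n ^ 'n \<Rightarrow> real ^ 'n::finite \<Rightarrow> (real ^ 'n) set" where
  "ab_dom J a b = {y. y \<noteq> 0 \<and> ab_s a b y \<in> J}"

definition ab_m :: "real ^ 'n ^ 'n \<Rightarrow> real ^ 'n::finite \<Rightarrow> 'n \<Rightarrow> real ^ 'n \<Rightarrow> real" where
  "ab_m a b i y = b $ i - ab_s a b y * partial i (alpha a) y"

definition ab_dom_star :: "real set \<Rightarrow> real ^ 'n ^ 'n \<Rightarrow> real ^ 'n::finite \<Rightarrow> (real ^ 'n) set" where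
  "ab_dom_star J a b = {y \<in> ab_dom J a b. \<exists>i. ab_m a b i y \<noteq> 0}"


definition T_condition :: "('m, 'n::finite) chart set \<Rightarrow> (('m, 'n) chart \<Rightarrow> 'm \<Rightarrow> real ^ 'n ^ 'n) \<Rightarrow>
    (('m, 'n) chart \<Rightarrow> 'm \<Rightarrow> real ^ 'n) \<Rightarrow> real set \<Rightarrow> (real \<Rightarrow> real) \<Rightarrow> bool" where
  "T_condition \<A> a b J \<phi> \<longleftrightarrow>
     (\<forall>\<kappa>\<in>\<A>. \<forall>p\<in>fst \<kappa>. \<forall>y\<in>ab_dom_star J (a \<kappa> p) (b \<kappa> p). \<forall>h i j k.
        T_tensor (ab_F \<phi> (a \<kappa> p) (b \<kappa> p)) h i j k y = 0)"

definition F_riemannian :: "('m, 'n::finite) chart set \<Rightarrow> (('m, 'n) chart \<Rightarrow> 'm \<Rightarrow> real ^ 'n ^ 'n) \<Rightarrow>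
    (('m, 'n) chart \<Rightarrow> 'm \<Rightarrow> real ^ 'n) \<Rightarrow> real set \<Rightarrow> (real \<Rightarrow> real) \<Rightarrow> bool" where
  "F_riemannian \<A> a b J \<phi> \<longleftrightarrow>
     (\<forall>\<kappa>\<in>\<A>. \<forall>p\<in>fst \<kappa>. \<forall>y\<in>ab_dom J (a \<kappa> p) (b \<kappa> p). \<forall>z\<in>ab_dom J (a \<kappa> p) (b \<kappa> p). \<forall>i j.
        fund (ab_F \<phi> (a \<kappa> p) (b \<kappa> p)) i j y = fund (ab_F \<phi> (a \<kappa> p) (b \<kappa> p)) i j z)"

end

theory Submission
  imports Defs
begin

text \<open>
  In terms of \<open>n\<^sub>i = \<partial>\<alpha>/\<partial>y\<^sup>i\<close>, \<open>m\<^sub>i = b\<^sub>i - s n\<^sub>i\<close> and the angular metric \<open>h\<^sub>i\<^sub>j = a\<^sub>i\<^sub>j - n\<^sub>i n\<^sub>j\<close> of \<open>\<alpha>\<close>, whose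
  derivatives in \<open>y\<close> are again polynomials in \<open>n, m, h\<close> and \<open>1/\<alpha>\<close>, the T-tensor takes the form
  \<open>2\<alpha>T = \<Phi>(s) \<Sigma>hh + \<Psi>(s) \<Sigma>hmm + \<Omega>(s) mmmm\<close>.

  If \<open>T = 0\<close>, contracting four times with a vector orthogonal to \<open>y\<close> and \<open>b\<close> (this is where \<open>n \<ge> 3\<close>
  enters) gives \<open>\<Phi> = 0\<close>. With \<open>\<eta> = \<phi>(\<phi> - s\<phi>')\<close> and \<open>M = b\<^sup>2 - s\<^sup>2\<close>, the equation \<open>\<Phi> = 0\<close> factors, and
  nondegeneracy forbids common zeros of the factors at \<open>s \<noteq> 0\<close>; by connectedness either \<open>\<eta>\<close> is
  constant, so that \<open>\<phi>\<^sup>2\<close> is a quadratic polynomial \<open>p + q s\<^sup>2\<close> and \<open>F\<close> is Riemannian, or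
  \<open>M (\<phi> - s\<phi>')/\<phi> = 1/c\<close> is constant. The solutions of the latter equation are the asserted ones. They
  are incompatible with \<open>0 \<in> J\<close>, which would force \<open>c b\<^sup>2 = 1\<close> and a degenerate \<open>g\<close>; and comparing two
  points of the manifold on the common range of \<open>s\<close> shows that \<open>c\<close> and \<open>b\<^sup>2\<close> are constant and that
  the two alternatives do not mix. Conversely \<open>\<Phi>\<close>, \<open>\<Psi>\<close>, \<open>\<Omega>\<close> all vanish for these solutions.
\<close>

section \<open>Partial derivatives\<close>

text \<open>On an open set, agreement of two functions passes to their derivatives at every point,
  so the induction can run over the directional derivatives.\<close>

lemma Ck_on_cong:
  assumes "open S" "\<And>x. x \<in> S \<Longrightarrow> f x = g x" "Ck_on k S f"
  shows "Ck_on k S g"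
  using assms(2,3)
proof (induction k arbitrary: f g)
  case 0
  then show ?case using continuous_on_cong by (metis Ck_on.simps(1))
next
  case (Suc k)
  have d: "f differentiable (at x)" if "x \<in> S" for x
    using Suc.prems(2) that \<open>open S\<close> by (simp add: differentiable_on_eq_differentiable_at)
  have eq: "frechet_derivative f (at x) = frechet_derivative g (at x)" if "x \<in> S" for x
    using frechet_derivative_transform_within_open[OF d[OF that] \<open>open S\<close> that] Suc.prems(1) by blast
  have "g differentiable_on S"
    unfolding differentiable_on_eq_differentiable_at[OF \<open>open S\<close>]
    using d Suc.prems(1) \<open>open S\<close> has_derivative_transform_within_open
    unfolding differentiable_def by meson
  moreover have "Ck_on k S (\<lambda>x. frechet_derivative g (at x) v)" for v
    by (rule Suc.IH[of "\<lambda>x. frechet_derivative f (at x) v"]) (use Suc.prems(2) eq in auto)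
  ultimately show ?case by simp
qed

text \<open>The directional derivative along 1 is \<open>deriv\<close>, so order k+1 of
  \<open>f\<close> contains order k of \<open>deriv f\<close>. Iteration supplies the four
  derivatives of \<phi> that the T-tensor requires.\<close>

lemma smooth_on_real_deriv:
  fixes f :: "real \<Rightarrow> real"
  assumes "open S" "smooth_on S f"
  shows "\<And>x. x \<in> S \<Longrightarrow> (f has_real_derivative deriv f x) (at x)" and "smooth_on S (deriv f)"
proof -
  have "f differentiable_on S"
    using assms(2) unfolding smooth_on_def by (metis Ck_on.simps(2))
  then show D: "(f has_real_derivative deriv f x) (at x)" if "x \<in> S" for x
    using that assms(1)
    by (simp add: DERIV_deriv_iff_real_differentiable differentiable_on_eq_differentiable_at)
  have "frechet_derivative f (at x) 1 = deriv f x" if "x \<in> S" for x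
    using frechet_derivative_at[OF D[OF that, unfolded has_field_derivative_def]] by (metis mult.right_neutral)
  then show "smooth_on S (deriv f)"
    using assms Ck_on_cong[OF assms(1), of "\<lambda>x. frechet_derivative f (at x) 1" "deriv f"]
    unfolding smooth_on_def by (metis Ck_on.simps(2))
qed

lemma matrix_inv_mult:
  assumes "invertible A"
  shows "A ** matrix_inv A = mat 1" "matrix_inv A ** A = mat 1"
  using someI_ex[OF assms[unfolded invertible_def]] unfolding matrix_inv_def by auto

text \<open>Two vectors span at most a plane, which is a proper subspace in dimension at least 3.
  The hypothesis on the dimension enters only through such a vector.\<close>

lemma exists_orthogonal_to_pair:
  fixes v w :: "real ^ 'n::finite"
  assumes "CARD('n) \<ge> 3"
  obtains u where "u \<noteq> 0" "v \<bullet> u = 0" "w \<bullet> u = 0"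
proof -
  have "dim {v, w} \<le> card {v, w}" by (rule dim_le_card') simp
  also have "\<dots> \<le> 2" by (simp add: card_insert_if)
  finally have "dim {v, w} < DIM(real ^ 'n)" using assms by simp
  then obtain u where u: "u \<noteq> 0" "\<And>x. x \<in> span {v, w} \<Longrightarrow> orthogonal u x"
    using orthogonal_to_subspace_exists by blast
  have "v \<bullet> u = 0" "w \<bullet> u = 0"
    using u(2)[OF span_base[of v "{v, w}"]] u(2)[OF span_base[of w "{v, w}"]]
    by (simp_all add: orthogonal_def inner_commute)
  then show thesis using that u(1) by blast
qed

text \<open>\<open>partial\<close> is total, as \<open>deriv\<close> is, and says nothing about
  existence. The relational form records existence and value together, so that the rules of calculus
  can be chained.\<close>

definition has_partial :: "'n::finite \<Rightarrow> (real ^ 'n \<Rightarrow> real) \<Rightarrow> real \<Rightarrow> real ^ 'n \<Rightarrow> bool" where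
  "has_partial i f d y \<longleftrightarrow> ((\<lambda>t. f (y + t *\<^sub>R axis i 1)) has_real_derivative d) (at 0)"

lemma partial_eqI: "has_partial i f d y \<Longrightarrow> partial i f y = d"
  unfolding has_partial_def partial_def by (rule DERIV_imp_deriv)

text \<open>Separates two halves of a computation: the introduction rules produce the derivative in
  raw form, and an algebraic identity brings it to the wanted form.\<close>

lemma has_partial_eq: "has_partial i f d y \<Longrightarrow> d = e \<Longrightarrow> has_partial i f e y"
  by simp

text \<open>Higher derivatives are reached in this way: a lower derivative is replaced by its closed
  formula, known only on an open set, before it is differentiated again.\<close>

lemma has_partial_transform:
  assumes "open U" "y \<in> U" "\<And>z. z \<in> U \<Longrightarrow> f z = g z" "has_partial i g d y"
  shows "has_partial i f d y"
proof -
  have "open ((\<lambda>t. y + t *\<^sub>R axis i 1) -` U)"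
    by (intro open_vimage assms(1) continuous_intros)
  then show ?thesis
    using assms(2-4) unfolding has_partial_def
    by (elim has_field_derivative_transform_within_open) auto
qed

lemma has_partial_const: "has_partial i (\<lambda>z. c) 0 y"
  by (simp add: has_partial_def)

lemma has_partial_add:
  "has_partial i f d y \<Longrightarrow> has_partial i g e y \<Longrightarrow> has_partial i (\<lambda>z. f z + g z) (d + e) y"
  unfolding has_partial_def by (rule DERIV_add)

lemma has_partial_diff:
  "has_partial i f d y \<Longrightarrow> has_partial i g e y \<Longrightarrow> has_partial i (\<lambda>z. f z - g z) (d - e) y"
  unfolding has_partial_def by (rule DERIV_diff)

lemma has_partial_mult:
  "has_partial i f d y \<Longrightarrow> has_partial i g e y \<Longrightarrow>
    has_partial i (\<lambda>z. f z * g z) (d * g y + e * f y) y"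
  unfolding has_partial_def by (drule (1) DERIV_mult) simp

lemma has_partial_divide:
  "has_partial i f d y \<Longrightarrow> has_partial i g e y \<Longrightarrow> g y \<noteq> 0 \<Longrightarrow>
    has_partial i (\<lambda>z. f z / g z) ((d * g y - f y * e) / (g y * g y)) y"
  unfolding has_partial_def by (drule (1) DERIV_divide) simp_all

lemma has_partial_compose:
  "(\<phi> has_real_derivative D) (at (f y)) \<Longrightarrow> has_partial i f d y \<Longrightarrow>
    has_partial i (\<lambda>z. \<phi> (f z)) (D * d) y"
  unfolding has_partial_def by (rule DERIV_chain2) simp_all

lemmas has_partial_intros =
  has_partial_const has_partial_add has_partial_diff has_partial_mult has_partial_divide

lemma has_partial_inner: "has_partial i (\<lambda>z. c \<bullet> z) (c $ i) y"
  unfolding has_partial_def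
  by (auto intro!: derivative_eq_intros simp: inner_add_right inner_axis)

section \<open>The Euclidean geometry of a tangent space\<close>

locale ab_tangent =
  fixes a :: "real ^ 'n::finite ^ 'n" and b :: "real ^ 'n"
  assumes sym: "a $ i $ j = a $ j $ i"
    and posdef: "v \<noteq> 0 \<Longrightarrow> v \<bullet> (a *v v) > 0"
    and b_nonzero: "b \<noteq> 0"
begin

text \<open>These are closed formulas. For \<open>y \<noteq> 0\<close>, \<open>n\<close> turns out
  to be the gradient of \<open>alpha\<close>, while \<open>m\<close> and \<open>h\<close> are
  \<open>alpha\<close> times the derivatives of \<open>s\<close> and of \<open>n\<close>.\<close>

definition n :: "'n \<Rightarrow> real ^ 'n \<Rightarrow> real" where
  "n i y = (a *v y) $ i / alpha a y"

definition m :: "'n \<Rightarrow> real ^ 'n \<Rightarrow> real" where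
  "m i y = b $ i - ab_s a b y * n i y"

definition h :: "'n \<Rightarrow> 'n \<Rightarrow> real ^ 'n \<Rightarrow> real" where
  "h i j y = a $ i $ j - n i y * n j y"

definition b_sharp :: "real ^ 'n" where
  "b_sharp = matrix_inv a *v b"

lemma transpose_a: "transpose a = a"
  by (simp add: transpose_def vec_eq_iff sym)

lemma self_adjoint: "u \<bullet> (a *v v) = v \<bullet> (a *v u)"
  by (metis dot_lmul_matrix inner_commute transpose_a transpose_matrix_vector)

lemma invertible_a: "invertible a"
proof -
  have "v = 0" if "a *v v = 0" for v
    using posdef[of v] that by fastforce
  then show ?thesis
    by (simp add: invertible_left_inverse matrix_left_invertible_ker)
qed

lemma a_b_sharp: "a *v b_sharp = b"
  unfolding b_sharp_def using invertible_a
  by (simp add: matrix_vector_mul_assoc matrix_inv_mult(1))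

lemma beta_inner: "beta b y = b \<bullet> y"
  by (simp add: beta_def inner_vec_def)

lemma bsq_inner: "bsq a b = b \<bullet> b_sharp"
  unfolding bsq_def b_sharp_def
  by (simp add: inner_vec_def matrix_vector_mult_def sum_distrib_left sum_distrib_right mult_ac)

lemma bsq_pos: "bsq a b > 0"
proof -
  have "b_sharp \<noteq> 0" using a_b_sharp b_nonzero by auto
  then show ?thesis
    using posdef[of b_sharp] by (simp add: bsq_inner a_b_sharp inner_commute)
qed

lemma alpha_inner: "alpha a y = sqrt (y \<bullet> (a *v y))"
  unfolding alpha_def
  by (simp add: inner_vec_def matrix_vector_mult_def sum_distrib_left mult_ac)

lemma alpha_pos: "y \<noteq> 0 \<Longrightarrow> alpha a y > 0"
  by (simp add: alpha_inner posdef)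

lemma alpha_sq: "(alpha a y)\<^sup>2 = y \<bullet> (a *v y)"
  using posdef[of y] by (cases "y = 0") (auto simp: alpha_inner)

lemma beta_eq: "y \<noteq> 0 \<Longrightarrow> b \<bullet> y = ab_s a b y * alpha a y"
  using alpha_pos[of y] by (simp add: ab_s_def beta_inner)

lemma h_sym: "h i j y = h j i y"
  by (simp add: h_def sym mult.commute)

section \<open>Contractions of \<open>n\<close>, \<open>m\<close> and \<open>h\<close> with
  vectors\<close>

lemma n_inner: "(\<Sum>i\<in>UNIV. n i y * v $ i) = (v \<bullet> (a *v y)) / alpha a y"
  by (simp add: n_def inner_vec_def sum_divide_distrib mult_ac)

lemma m_inner: "(\<Sum>i\<in>UNIV. m i y * v $ i) = b \<bullet> v - ab_s a b y * ((v \<bullet> (a *v y)) / alpha a y)"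
  unfolding n_inner[symmetric]
  by (simp add: m_def inner_vec_def sum_subtractf sum_distrib_left algebra_simps)

lemma h_inner: "(\<Sum>j\<in>UNIV. h i j y * v $ j) = (a *v v) $ i - n i y * ((v \<bullet> (a *v y)) / alpha a y)"
  unfolding n_inner[symmetric]
  by (simp add: h_def matrix_vector_mult_def sum_subtractf sum_distrib_left algebra_simps)

text \<open>This and the next two are Euler's relations: \<open>alpha\<close> is homogeneous of
  degree 1 in \<open>y\<close>, while \<open>s\<close> and \<open>n\<close> have degree 0.\<close>

lemma n_y: "y \<noteq> 0 \<Longrightarrow> (\<Sum>i\<in>UNIV. n i y * y $ i) = alpha a y"
  using alpha_pos[of y] by (simp add: n_inner alpha_sq[symmetric] power2_eq_square)

lemma m_y: "y \<noteq> 0 \<Longrightarrow> (\<Sum>i\<in>UNIV. m i y * y $ i) = 0"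
  using alpha_pos[of y] by (simp add: m_inner beta_eq alpha_sq[symmetric] power2_eq_square)

lemma h_y: "y \<noteq> 0 \<Longrightarrow> (\<Sum>j\<in>UNIV. h i j y * y $ j) = 0"
  using alpha_pos[of y] by (simp add: h_inner alpha_sq[symmetric] power2_eq_square n_def)

text \<open>At multiples of \<open>b_sharp\<close> the ratio \<open>s\<close> is extremal. Adding a
  vector annihilated by \<open>b\<close> increases \<open>alpha\<close> and keeps
  \<open>beta\<close>, which realises the intermediate values.\<close>

lemma ab_s_surj:
  assumes "CARD('n) \<ge> 3" "t\<^sup>2 < bsq a b"
  obtains y where "y \<noteq> 0" "ab_s a b y = t"
proof -
  obtain u where u: "u \<noteq> 0" "b \<bullet> u = 0"
    using exists_orthogonal_to_pair[OF assms(1)] by blast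
  let ?B = "bsq a b" and ?q = "u \<bullet> (a *v u)"
  have q: "?q > 0" using posdef u(1) by blast
  \<comment> \<open>As \<open>b_sharp\<close> and \<open>u\<close> are orthogonal for
    \<open>a\<close>, this choice makes \<open>alpha a y = bsq a b\<close>, while
    \<open>b \<bullet> y = t * bsq a b\<close>.\<close>
  define r where "r = sqrt ((?B\<^sup>2 - t\<^sup>2 * ?B) / ?q)"
  define y where "y = t *\<^sub>R b_sharp + r *\<^sub>R u"
  have "?B\<^sup>2 - t\<^sup>2 * ?B = ?B * (?B - t\<^sup>2)" by (simp add: power2_eq_square algebra_simps)
  then have "?B\<^sup>2 - t\<^sup>2 * ?B \<ge> 0" using assms(2) bsq_pos by simp
  then have r: "r\<^sup>2 * ?q = ?B\<^sup>2 - t\<^sup>2 * ?B" using q by (simp add: r_def)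
  have "b_sharp \<bullet> (a *v u) = 0"
    unfolding self_adjoint[of b_sharp u] using u(2) by (simp add: a_b_sharp inner_commute)
  then have "y \<bullet> (a *v y) = t\<^sup>2 * ?B + r\<^sup>2 * ?q"
    using u(2)
    by (simp add: y_def matrix_vector_right_distrib matrix_vector_mult_scaleR a_b_sharp
        inner_add_left inner_add_right bsq_inner inner_commute power2_eq_square algebra_simps)
  then have "y \<bullet> (a *v y) = ?B\<^sup>2" by (simp add: r)
  then have al: "alpha a y = ?B" using bsq_pos by (simp add: alpha_inner)
  have "b \<bullet> y = t * ?B" by (simp add: y_def inner_add_right u(2) bsq_inner)
  then have "ab_s a b y = t" using bsq_pos by (simp add: ab_s_def beta_inner al)
  moreover have "y \<noteq> 0" using al bsq_pos by (auto simp: alpha_inner)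
  ultimately show thesis using that by blast
qed

text \<open>The covector \<open>m\<close> with its index raised by \<open>a\<close>: the component
  of \<open>b_sharp\<close> that is orthogonal to \<open>y\<close> with respect to
  \<open>a\<close>.\<close>

definition m_sharp :: "real ^ 'n \<Rightarrow> real ^ 'n" where
  "m_sharp y = b_sharp - (ab_s a b y / alpha a y) *\<^sub>R y"

lemma a_m_sharp: "(a *v m_sharp y) $ i = m i y"
  by (simp add: m_sharp_def matrix_vector_mult_diff_distrib a_b_sharp m_def n_def
      matrix_vector_mult_scaleR)

lemma m_sharp_y: "y \<noteq> 0 \<Longrightarrow> m_sharp y \<bullet> (a *v y) = 0"
  using alpha_pos[of y]
  by (simp add: m_sharp_def inner_diff_left self_adjoint[of b_sharp] a_b_sharp inner_commute[of y b]
      beta_eq alpha_sq[symmetric] power2_eq_square)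

lemma n_m_sharp: "y \<noteq> 0 \<Longrightarrow> (\<Sum>i\<in>UNIV. n i y * m_sharp y $ i) = 0"
  by (simp add: n_inner m_sharp_y)

lemma m_m_sharp: "y \<noteq> 0 \<Longrightarrow> (\<Sum>i\<in>UNIV. m i y * m_sharp y $ i) = bsq a b - (ab_s a b y)\<^sup>2"
  using alpha_pos[of y]
  by (simp add: m_inner m_sharp_y)
     (simp add: m_sharp_def inner_diff_right bsq_inner beta_eq power2_eq_square)

lemma h_m_sharp: "y \<noteq> 0 \<Longrightarrow> (\<Sum>j\<in>UNIV. h i j y * m_sharp y $ j) = m i y"
  by (simp add: h_inner m_sharp_y a_m_sharp)

lemma m_norm: "y \<noteq> 0 \<Longrightarrow> m_sharp y \<bullet> (a *v m_sharp y) = bsq a b - (ab_s a b y)\<^sup>2"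
  unfolding m_m_sharp[symmetric] by (simp add: inner_vec_def a_m_sharp mult.commute)

text \<open>Cauchy-Schwarz for \<open>b\<close> and \<open>y\<close>, read off from the norm of
  \<open>m_sharp y\<close>.\<close>

lemma ab_s_le: "y \<noteq> 0 \<Longrightarrow> (ab_s a b y)\<^sup>2 \<le> bsq a b"
  using posdef[of "m_sharp y"] m_norm[of y] by (cases "m_sharp y = 0") auto

lemma m_nonzero_iff:
  assumes "y \<noteq> 0"
  shows "(\<exists>i. m i y \<noteq> 0) \<longleftrightarrow> (ab_s a b y)\<^sup>2 < bsq a b"
proof -
  have "(\<exists>i. m i y \<noteq> 0) \<longleftrightarrow> m_sharp y \<noteq> 0"
    by (metis a_m_sharp invertible_a matrix_left_invertible_ker invertible_left_inverse vec_eq_iff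
        zero_index matrix_vector_mult_0_right)
  then show ?thesis
    using posdef[of "m_sharp y"] m_norm[OF assms] by (cases "m_sharp y = 0") auto
qed

section \<open>Derivatives of \<open>alpha\<close>, \<open>s\<close>, \<open>n\<close>,
  \<open>m\<close> and \<open>h\<close> in \<open>y\<close>\<close>

lemma has_partial_alpha:
  assumes "y \<noteq> 0"
  shows "has_partial i (alpha a) (n i y) y"
proof -
  have "has_partial i (\<lambda>z. z \<bullet> (a *v z)) (2 * (a *v y) $ i) y"
    unfolding has_partial_def
    by (auto intro!: derivative_eq_intros
        simp: matrix_vector_right_distrib matrix_vector_mult_scaleR inner_add_left inner_add_right
          self_adjoint[of y "axis i 1"] inner_axis inner_axis')
  then have "has_partial i (\<lambda>z. sqrt (z \<bullet> (a *v z))) (inverse (sqrt (y \<bullet> (a *v y))) / 2 * (2 * (a *v y) $ i)) y"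
    using posdef[OF assms] by (intro has_partial_compose[of sqrt] DERIV_real_sqrt) auto
  moreover have "alpha a = (\<lambda>z. sqrt (z \<bullet> (a *v z)))"
    by (rule ext) (rule alpha_inner)
  ultimately show ?thesis
    by (simp add: n_def field_simps)
qed

lemma partial_alpha: "y \<noteq> 0 \<Longrightarrow> partial i (alpha a) y = n i y"
  by (intro partial_eqI has_partial_alpha)

lemma ab_m_eq: "y \<noteq> 0 \<Longrightarrow> ab_m a b i y = m i y"
  by (simp add: ab_m_def m_def partial_alpha)

lemma has_partial_s:
  assumes "y \<noteq> 0"
  shows "has_partial i (ab_s a b) (m i y / alpha a y) y"
proof -
  have "has_partial i (\<lambda>z. (b \<bullet> z) / alpha a z)
      ((b $ i * alpha a y - (b \<bullet> y) * n i y) / (alpha a y * alpha a y)) y"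
    using alpha_pos[OF assms]
    by (intro has_partial_divide has_partial_inner has_partial_alpha assms) simp
  moreover have "(b $ i * alpha a y - (b \<bullet> y) * n i y) / (alpha a y * alpha a y) = m i y / alpha a y"
    using alpha_pos[OF assms] by (simp add: m_def beta_eq[OF assms] field_simps)
  moreover have "ab_s a b = (\<lambda>z. (b \<bullet> z) / alpha a z)"
    by (rule ext) (simp add: ab_s_def beta_inner)
  ultimately show ?thesis by metis
qed

lemma has_partial_n:
  assumes "y \<noteq> 0"
  shows "has_partial j (n i) (h i j y / alpha a y) y"
proof -
  have "has_partial j (\<lambda>z. (a $ i) \<bullet> z / alpha a z)
      ((a $ i $ j * alpha a y - ((a $ i) \<bullet> y) * n j y) / (alpha a y * alpha a y)) y"
    using alpha_pos[OF assms]
    by (intro has_partial_divide has_partial_inner has_partial_alpha assms) simp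
  then show ?thesis
    using alpha_pos[OF assms]
    by (simp add: n_def[abs_def] h_def matrix_vector_mul_component field_simps)
qed

lemma has_partial_m:
  assumes "y \<noteq> 0"
  shows "has_partial j (m i) (- (m j y * n i y + ab_s a b y * h i j y) / alpha a y) y"
proof -
  have "has_partial j (\<lambda>z. b $ i - ab_s a b z * n i z)
     (0 - (m j y / alpha a y * n i y + h i j y / alpha a y * ab_s a b y)) y"
    by (intro has_partial_intros has_partial_s has_partial_n assms)
  moreover have "0 - (m j y / alpha a y * n i y + h i j y / alpha a y * ab_s a b y)
      = - (m j y * n i y + ab_s a b y * h i j y) / alpha a y"
    using alpha_pos[OF assms] by (simp add: field_simps)
  moreover have "m i = (\<lambda>z. b $ i - ab_s a b z * n i z)"
    by (rule ext) (rule m_def)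
  ultimately show ?thesis by metis
qed

lemma has_partial_h:
  assumes "y \<noteq> 0"
  shows "has_partial k (h i j) (- (h i k y * n j y + h j k y * n i y) / alpha a y) y"
proof -
  have "has_partial k (\<lambda>z. a $ i $ j - n i z * n j z)
     (0 - (h i k y / alpha a y * n j y + h j k y / alpha a y * n i y)) y"
    by (intro has_partial_intros has_partial_n assms)
  moreover have "0 - (h i k y / alpha a y * n j y + h j k y / alpha a y * n i y)
      = - (h i k y * n j y + h j k y * n i y) / alpha a y"
    using alpha_pos[OF assms] by (simp add: field_simps)
  moreover have "h i j = (\<lambda>z. a $ i $ j - n i z * n j z)"
    by (rule ext) (rule h_def)
  ultimately show ?thesis by metis
qed

lemma continuous_on_ab_s: "continuous_on (- {0}) (ab_s a b)"
proof -
  have "continuous_on (- {0}) (\<lambda>y. a *v y)"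
    by (rule linear_continuous_on[OF matrix_vector_mul_bounded_linear])
  then have "continuous_on (- {0}) (\<lambda>y. sqrt (y \<bullet> (a *v y)))"
    by (rule continuous_on_real_sqrt[OF continuous_on_inner[OF continuous_on_id]])
  moreover have "continuous_on (- {0}) (\<lambda>y. b \<bullet> y)"
    by (rule continuous_on_inner[OF continuous_on_const continuous_on_id])
  moreover have "\<forall>y\<in>- {0}. sqrt (y \<bullet> (a *v y)) \<noteq> 0"
  proof
    fix y :: "real ^ 'n"
    assume "y \<in> - {0}"
    then have "alpha a y > 0" by (intro alpha_pos) simp
    then show "sqrt (y \<bullet> (a *v y)) \<noteq> 0" unfolding alpha_inner by linarith
  qed
  ultimately have "continuous_on (- {0}) (\<lambda>y. (b \<bullet> y) / sqrt (y \<bullet> (a *v y)))"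
    by (intro continuous_on_divide)
  moreover have "ab_s a b = (\<lambda>y. (b \<bullet> y) / sqrt (y \<bullet> (a *v y)))"
    by (rule ext) (simp only: ab_s_def beta_inner alpha_inner)
  ultimately show ?thesis by (simp only:)
qed

lemma open_ab_dom: "open J \<Longrightarrow> open (ab_dom J a b)"
proof -
  assume "open J"
  then have "open (- {0} \<inter> ab_s a b -` J)"
    by (rule continuous_open_preimage[OF continuous_on_ab_s open_Compl[OF closed_singleton]])
  also have "- {0} \<inter> ab_s a b -` J = ab_dom J a b" by (auto simp: ab_dom_def)
  finally show ?thesis .
qed

lemma ab_dom_star_iff:
  "y \<in> ab_dom_star J a b \<longleftrightarrow> y \<in> ab_dom J a b \<and> (ab_s a b y)\<^sup>2 < bsq a b"
  using m_nonzero_iff[of y] by (auto simp: ab_dom_star_def ab_dom_def ab_m_eq)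

end

section \<open>The T-tensor of an \<open>(\<alpha>,\<beta>)\<close>-metric\<close>

text \<open>Four derivatives of \<phi> are carried as parameters, because the T-tensor contains
  fourth derivatives of \<open>F^2\<close>.\<close>

locale ab_jet = ab_tangent a b
  for a :: "real ^ 'n::finite ^ 'n" and b :: "real ^ 'n" +
  fixes J :: "real set" and f0 f1 f2 f3 f4 :: "real \<Rightarrow> real"
  assumes open_J: "open J"
    and deriv_f0: "t \<in> J \<Longrightarrow> (f0 has_real_derivative f1 t) (at t)"
    and deriv_f1: "t \<in> J \<Longrightarrow> (f1 has_real_derivative f2 t) (at t)"
    and deriv_f2: "t \<in> J \<Longrightarrow> (f2 has_real_derivative f3 t) (at t)"
    and deriv_f3: "t \<in> J \<Longrightarrow> (f3 has_real_derivative f4 t) (at t)"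
begin

text \<open>\<open>k\<close> is half the derivative of \<open>f0^2\<close>, and the primed names are
  successive derivatives. \<eta> will be the coefficient of \<open>h\<close> in the fundamental
  tensor.\<close>

definition k :: "real \<Rightarrow> real" where "k t = f0 t * f1 t"
definition k' :: "real \<Rightarrow> real" where "k' t = (f1 t)\<^sup>2 + f0 t * f2 t"
definition \<eta> :: "real \<Rightarrow> real" where "\<eta> t = (f0 t)\<^sup>2 - t * k t"
definition \<eta>' :: "real \<Rightarrow> real" where "\<eta>' t = k t - t * k' t"
definition k'' :: "real \<Rightarrow> real" where "k'' t = 3 * f1 t * f2 t + f0 t * f3 t"
definition k''' :: "real \<Rightarrow> real" where "k''' t = 3 * (f2 t)\<^sup>2 + 4 * f1 t * f3 t + f0 t * f4 t"

lemma deriv_k: "t \<in> J \<Longrightarrow> (k has_real_derivative k' t) (at t)"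
  unfolding k_def[abs_def]
  by (auto intro!: derivative_eq_intros deriv_f0 deriv_f1 simp: k'_def power2_eq_square algebra_simps)

lemma deriv_k': "t \<in> J \<Longrightarrow> (k' has_real_derivative k'' t) (at t)"
  unfolding k'_def[abs_def]
  by (auto intro!: derivative_eq_intros deriv_f0 deriv_f1 deriv_f2 simp: k''_def power2_eq_square algebra_simps)

lemma deriv_k'': "t \<in> J \<Longrightarrow> (k'' has_real_derivative k''' t) (at t)"
  unfolding k''_def[abs_def]
  by (auto intro!: derivative_eq_intros deriv_f0 deriv_f1 deriv_f2 deriv_f3
      simp: k'''_def power2_eq_square algebra_simps)

lemma deriv_\<eta>: "t \<in> J \<Longrightarrow> (\<eta> has_real_derivative \<eta>' t) (at t)"
  unfolding \<eta>_def[abs_def] k_def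
  by (auto intro!: derivative_eq_intros deriv_f0 deriv_f1 simp: \<eta>'_def k_def k'_def power2_eq_square algebra_simps)

text \<open>The contributions of \<open>k'\<close> cancel, so differentiating \<open>\<eta>'\<close>
  brings in no function besides \<open>k''\<close>.\<close>

lemma deriv_\<eta>': "t \<in> J \<Longrightarrow> (\<eta>' has_real_derivative - t * k'' t) (at t)"
  unfolding \<eta>'_def[abs_def]
  by (auto intro!: derivative_eq_intros deriv_k deriv_k')

lemma ab_domD:
  assumes "y \<in> ab_dom J a b"
  shows "y \<noteq> 0" "ab_s a b y \<in> J" "alpha a y > 0" "alpha a y \<noteq> 0"
  using assms alpha_pos[of y] by (auto simp: ab_dom_def)

lemma has_partial_of_s:
  assumes "y \<in> ab_dom J a b" "(f has_real_derivative D) (at (ab_s a b y))"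
  shows "has_partial i (\<lambda>z. f (ab_s a b z)) (D * (m i y / alpha a y)) y"
  using has_partial_compose[where f = "ab_s a b", OF assms(2) has_partial_s] ab_domD(1)[OF assms(1)]
  by blast

abbreviation "F \<equiv> ab_F f0 a b"

section \<open>The fundamental tensor, the Cartan tensor and its derivative\<close>

lemma has_partial_F:
  assumes "y \<in> ab_dom J a b"
  shows "has_partial i F (f0 (ab_s a b y) * n i y + f1 (ab_s a b y) * m i y) y"
proof -
  note y = ab_domD[OF assms]
  have "has_partial i (\<lambda>z. alpha a z * f0 (ab_s a b z)) (f0 (ab_s a b y) * n i y + f1 (ab_s a b y) * m i y) y"
    by (rule has_partial_eq, (rule has_partial_mult has_partial_alpha y has_partial_of_s assms(1) deriv_f0)+)
       (use y in \<open>simp add: field_simps\<close>)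
  moreover have "F = (\<lambda>z. alpha a z * f0 (ab_s a b z))"
    by (rule ext) (rule ab_F_def)
  ultimately show ?thesis by metis
qed

lemma partial_F_sq:
  assumes "y \<in> ab_dom J a b"
  shows "partial j (\<lambda>z. (F z)\<^sup>2) y
    = 2 * (alpha a y * ((f0 (ab_s a b y))\<^sup>2 * n j y + k (ab_s a b y) * m j y))"
  unfolding power2_eq_square
  by (rule partial_eqI, rule has_partial_eq, (rule has_partial_mult has_partial_F assms(1))+)
     (simp add: ab_F_def k_def algebra_simps)

definition g :: "'n \<Rightarrow> 'n \<Rightarrow> real ^ 'n \<Rightarrow> real" where
  "g i j y = (f0 (ab_s a b y))\<^sup>2 * (n i y * n j y) + k (ab_s a b y) * (n i y * m j y + m i y * n j y)
     + \<eta> (ab_s a b y) * h i j y + k' (ab_s a b y) * (m i y * m j y)"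

lemma fund_eq:
  assumes "y \<in> ab_dom J a b"
  shows "fund F i j y = g i j y"
proof -
  note y = ab_domD[OF assms]
  have "has_partial i (\<lambda>z. 2 * (alpha a z * (f0 (ab_s a b z) * f0 (ab_s a b z) * n j z + k (ab_s a b z) * m j z)))
      (2 * g i j y) y"
    by (rule has_partial_eq, (rule has_partial_intros has_partial_alpha has_partial_n has_partial_m y
        has_partial_of_s assms(1) deriv_f0 deriv_k)+)
       (use y in \<open>simp add: g_def \<eta>_def k_def h_sym[of j i] power2_eq_square field_simps\<close>)
  then have "has_partial i (partial j (\<lambda>z. (F z)\<^sup>2)) (2 * g i j y) y"
    by (rule has_partial_transform[OF open_ab_dom[OF open_J] assms, rotated])
       (simp add: partial_F_sq[unfolded power2_eq_square] power2_eq_square)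
  then show ?thesis by (simp add: fund_def partial_eqI)
qed

text \<open>This is \<open>2 * alpha a y\<close> times the Cartan tensor. No \<open>n\<close>
  occurs, in accordance with the fact that the Cartan tensor annihilates \<open>y\<close>.\<close>

definition Y :: "'n \<Rightarrow> 'n \<Rightarrow> 'n \<Rightarrow> real ^ 'n \<Rightarrow> real" where
  "Y i j l y = \<eta>' (ab_s a b y) * (h i j y * m l y + h i l y * m j y + h j l y * m i y)
     + k'' (ab_s a b y) * (m i y * m j y * m l y)"

lemma cartan_eq:
  assumes "y \<in> ab_dom J a b"
  shows "cartan F i j l y = Y i j l y / (2 * alpha a y)"
proof -
  note y = ab_domD[OF assms]
  have "has_partial l (\<lambda>z. f0 (ab_s a b z) * f0 (ab_s a b z) * (n i z * n j z)
      + k (ab_s a b z) * (n i z * m j z + m i z * n j z)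
      + \<eta> (ab_s a b z) * h i j z + k' (ab_s a b z) * (m i z * m j z)) (Y i j l y / alpha a y) y"
    by (rule has_partial_eq, (rule has_partial_intros has_partial_alpha has_partial_n has_partial_m
        has_partial_h y has_partial_of_s assms(1) deriv_f0 deriv_k deriv_k' deriv_\<eta>)+)
       (use y in \<open>simp add: Y_def \<eta>_def \<eta>'_def k_def power2_eq_square field_simps\<close>)
  then have "has_partial l (fund F i j) (Y i j l y / alpha a y) y"
    by (rule has_partial_transform[OF open_ab_dom[OF open_J] assms, rotated])
       (simp add: fund_eq g_def power2_eq_square)
  then show ?thesis by (simp add: cartan_def partial_eqI)
qed

text \<open>All six terms of type h m m share one coefficient: three come from the derivative
  \<open>- s * k'' s\<close> of \<open>\<eta>'\<close>, three from differentiating the product m m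
  m, with the same factor.\<close>

lemma cartan_dot_eq:
  assumes "y \<in> ab_dom J a b"
  defines "s \<equiv> ab_s a b y"
  shows "cartan_dot F r i j l y =
    (- (n r y * Y i j l y + n i y * Y r j l y + n j y * Y r i l y + n l y * Y r i j y)
     - s * \<eta>' s * (h r i y * h j l y + h r j y * h i l y + h r l y * h i j y)
     - s * k'' s * (h r i y * (m j y * m l y) + h r j y * (m i y * m l y) + h r l y * (m i y * m j y)
         + h i j y * (m r y * m l y) + h i l y * (m r y * m j y) + h j l y * (m r y * m i y))
     + k''' s * (m r y * m i y * (m j y * m l y))) / (2 * (alpha a y)\<^sup>2)" (is "_ = ?R / _")
proof -
  note y = ab_domD[OF assms(1)]
  have "has_partial r (\<lambda>z. (\<eta>' (ab_s a b z) * (h i j z * m l z + h i l z * m j z + h j l z * m i z)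
     + k'' (ab_s a b z) * (m i z * m j z * m l z)) / (2 * alpha a z)) (?R / (2 * (alpha a y)\<^sup>2)) y"
    by (rule has_partial_eq, (rule has_partial_intros has_partial_alpha has_partial_n has_partial_m
        has_partial_h y has_partial_of_s assms(1) deriv_\<eta>' deriv_k'')+, simp add: y)
       (use y in \<open>simp add: s_def[symmetric] Y_def h_sym[of _ r] power2_eq_square field_simps\<close>)
  then have "has_partial r (cartan F i j l) (?R / (2 * (alpha a y)\<^sup>2)) y"
    by (rule has_partial_transform[OF open_ab_dom[OF open_J] assms(1), rotated])
       (simp add: cartan_eq Y_def)
  then show ?thesis by (simp add: cartan_dot_def partial_eqI)
qed

section \<open>Contraction of the Cartan tensor with itself\<close>

definition M :: "real \<Rightarrow> real" where "M t = bsq a b - t\<^sup>2"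
text \<open>In the notation of the paper, \<open>\<Delta> = \<phi> (\<phi> - s\<phi>' + (b\<^sup>2 - s\<^sup>2) \<phi>'')\<close>.\<close>

definition \<Delta> :: "real \<Rightarrow> real" where "\<Delta> t = \<eta> t + M t * (f0 t * f2 t)"
text \<open>The coefficient of m m when \<open>Y\<close> is contracted with \<open>m_sharp\<close>;
  the coefficient of \<open>h\<close> is then \<open>\<eta>' * M\<close>.\<close>

definition G :: "real \<Rightarrow> real" where "G t = 2 * \<eta>' t + k'' t * M t"

lemma g_vec:
  "(\<Sum>j\<in>UNIV. g i j y * X j) = ((f0 (ab_s a b y))\<^sup>2 * n i y + k (ab_s a b y) * m i y) * (\<Sum>j\<in>UNIV. n j y * X j)
    + (k (ab_s a b y) * n i y + k' (ab_s a b y) * m i y) * (\<Sum>j\<in>UNIV. m j y * X j)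
    + \<eta> (ab_s a b y) * (\<Sum>j\<in>UNIV. h i j y * X j)"
  unfolding g_def by (simp add: sum.distrib sum_distrib_left algebra_simps)

lemma Y_vec:
  "(\<Sum>t\<in>UNIV. Y t i j y * X t) = \<eta>' (ab_s a b y) * (h i j y * (\<Sum>t\<in>UNIV. m t y * X t)
      + m j y * (\<Sum>t\<in>UNIV. h i t y * X t) + m i y * (\<Sum>t\<in>UNIV. h j t y * X t))
     + k'' (ab_s a b y) * (m i y * m j y) * (\<Sum>t\<in>UNIV. m t y * X t)"
  by (simp add: Y_def sum.distrib sum_distrib_left h_sym algebra_simps)

text \<open>The inverse of \<open>g\<close> is not computed. The vector \<open>X = g\<inverse> C\<close> is determined from \<open>g X = C\<close> by
  contracting this equation with \<open>y\<close> and with the vector \<open>m_sharp\<close> dual to \<open>m\<close>. The coefficient of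
  \<open>m m h\<close> is written with a difference of quotients so that the sum over the three index pairings
  becomes visibly symmetric.\<close>

lemma cartan_up_contract:
  assumes y: "y \<in> ab_dom J a b" and inv: "invertible (fund_mat F y)"
    and nz: "f0 (ab_s a b y) \<noteq> 0" "\<eta> (ab_s a b y) \<noteq> 0" "\<Delta> (ab_s a b y) \<noteq> 0"
  defines "s \<equiv> ab_s a b y"
  shows "4 * (alpha a y)\<^sup>2 * (\<Sum>t\<in>UNIV. cartan F t i j y * cartan_up F t r l y) =
    \<eta>' s / \<eta> s * (Y i r l y * m j y + Y j r l y * m i y)
    - (2 * (\<eta>' s)\<^sup>2 / \<eta> s - 2 * (\<eta>' s)\<^sup>2 / \<Delta> s) * (m i y * m j y * h r l y)
    - 2 * \<eta>' s * f0 s * f2 s * G s / (\<eta> s * \<Delta> s) * (m i y * m j y * (m r y * m l y))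
    + (\<eta>' s * h i j y + k'' s * (m i y * m j y)) * (\<eta>' s * M s * h r l y + G s * (m r y * m l y)) / \<Delta> s"
proof -
  note yD = ab_domD[OF y]
  define X where "X t = cartan_up F t r l y" for t
  define nX where "nX = (\<Sum>t\<in>UNIV. n t y * X t)"
  define mX where "mX = (\<Sum>t\<in>UNIV. m t y * X t)"
  define hX where "hX t = (\<Sum>j\<in>UNIV. h t j y * X j)" for t
  let ?A = "alpha a y"
  define c :: "real ^ 'n" where "c = (\<chi> t. cartan F t r l y)"
  have Xv: "X t = (matrix_inv (fund_mat F y) *v c) $ t" for t
    by (simp add: X_def cartan_up_def c_def matrix_vector_mult_def)
  have gX: "(\<Sum>j\<in>UNIV. g t j y * X j) = Y t r l y / (2 * ?A)" for t
  proof -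
    define v where "v = matrix_inv (fund_mat F y) *v c"
    have "fund_mat F y *v v = c"
      by (simp add: v_def matrix_vector_mul_assoc matrix_inv_mult(1)[OF inv])
    then have "(fund_mat F y *v v) $ t = c $ t" by simp
    then have "(\<Sum>j\<in>UNIV. g t j y * v $ j) = Y t r l y / (2 * ?A)"
      by (simp add: matrix_vector_mult_def c_def cartan_eq[OF y] fund_mat_def fund_eq[OF y])
    then show ?thesis unfolding v_def Xv .
  qed
  have eq: "((f0 s)\<^sup>2 * n t y + k s * m t y) * nX + (k s * n t y + k' s * m t y) * mX + \<eta> s * hX t
      = Y t r l y / (2 * ?A)" for t
    using gX[of t] unfolding g_vec nX_def mX_def hX_def s_def .
  \<comment> \<open>Symmetry of \<open>h\<close> moves the contraction from \<open>hX\<close> to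
    \<open>h\<close>, where the contractions with \<open>y\<close> and \<open>m_sharp\<close> are
    known.\<close>
  have hXv: "(\<Sum>t\<in>UNIV. hX t * v t) = (\<Sum>j\<in>UNIV. X j * (\<Sum>t\<in>UNIV. h j t y * v t))" for v
    unfolding hX_def sum_distrib_right sum_distrib_left
    by (subst sum.swap) (simp add: h_sym mult_ac)
  have contr: "((f0 s)\<^sup>2 * nX + k s * mX) * (\<Sum>t\<in>UNIV. n t y * v t)
      + (k s * nX + k' s * mX) * (\<Sum>t\<in>UNIV. m t y * v t) + \<eta> s * (\<Sum>t\<in>UNIV. hX t * v t)
      = (\<Sum>t\<in>UNIV. Y t r l y * v t) / (2 * ?A)" for v
  proof -
    have "(\<Sum>t\<in>UNIV. Y t r l y * v t) / (2 * ?A) = (\<Sum>t\<in>UNIV. Y t r l y / (2 * ?A) * v t)"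
      by (simp add: sum_divide_distrib)
    then show ?thesis
      unfolding eq[symmetric] by (simp add: sum.distrib sum_distrib_left algebra_simps)
  qed
  have "?A * ((f0 s)\<^sup>2 * nX + k s * mX) = 0"
    using contr[of "\<lambda>t. y $ t"] unfolding Y_vec hXv n_y[OF yD(1)] m_y[OF yD(1)] h_y[OF yD(1)]
    by (simp add: mult.commute)
  then have 1: "(f0 s)\<^sup>2 * nX + k s * mX = 0" using yD by simp
  then have "f0 s * (f0 s * nX + f1 s * mX) = 0"
    by (simp add: k_def power2_eq_square algebra_simps)
  then have "f0 s * nX + f1 s * mX = 0"
    using nz(1) by (simp add: s_def)
  then have nX_eq: "f0 s * nX = - f1 s * mX" by simp
  have Xm: "(\<Sum>j\<in>UNIV. X j * m j y) = mX" by (simp add: mX_def mult.commute)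
  have c3: "(k s * nX + k' s * mX) * M s + \<eta> s * mX
      = (\<eta>' s * (M s * h r l y + 2 * (m r y * m l y)) + k'' s * (m r y * m l y) * M s) / (2 * ?A)"
    using contr[of "\<lambda>t. m_sharp y $ t"] unfolding Y_vec hXv h_m_sharp[OF yD(1)] Xm
      n_m_sharp[OF yD(1)] m_m_sharp[OF yD(1)]
    by (simp add: M_def s_def algebra_simps)
  \<comment> \<open>Eliminates \<open>nX\<close>: now \<open>k * nX + k' * mX\<close> equals
    \<open>f0 * f2 * mX\<close>, and the total factor of \<open>mX\<close> in \<open>c3\<close>
    becomes \<Delta>.\<close>
  have knX: "k s * nX = - (f1 s)\<^sup>2 * mX"
  proof -
    have "k s * nX = f1 s * (f0 s * nX)" by (simp add: k_def)
    then show ?thesis by (simp add: nX_eq power2_eq_square)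
  qed
  have "(k s * nX + k' s * mX) * M s + \<eta> s * mX = \<Delta> s * mX"
    unfolding knX by (simp add: \<Delta>_def k'_def algebra_simps)
  with c3 have "\<Delta> s * mX = (\<eta>' s * (M s * h r l y + 2 * (m r y * m l y)) + k'' s * (m r y * m l y) * M s) / (2 * ?A)"
    by simp
  then have "\<Delta> s * mX = (\<eta>' s * M s * h r l y + G s * (m r y * m l y)) / (2 * ?A)"
    by (simp add: G_def algebra_simps)
  then have mX_eq: "mX = (\<eta>' s * M s * h r l y + G s * (m r y * m l y)) / (2 * ?A * \<Delta> s)"
    using nz(3) yD by (simp add: s_def field_simps)
  have "n t y * ((f0 s)\<^sup>2 * nX + k s * mX) + m t y * (k s * nX + k' s * mX) + \<eta> s * hX t = Y t r l y / (2 * ?A)" for t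
    using eq[of t] by (simp add: algebra_simps)
  then have hX_eq: "hX t = (Y t r l y / (2 * ?A) - f0 s * f2 s * mX * m t y) / \<eta> s" for t
    using nz(2) unfolding 1 knX k'_def by (simp add: s_def field_simps)
  have "(\<Sum>t\<in>UNIV. cartan F t i j y * cartan_up F t r l y) = (\<Sum>t\<in>UNIV. Y t i j y * X t) / (2 * ?A)"
    by (simp add: cartan_eq[OF y] X_def sum_divide_distrib)
  also have "\<dots> = (\<eta>' s * (h i j y * mX + m j y * hX i + m i y * hX j) + k'' s * (m i y * m j y) * mX) / (2 * ?A)"
    unfolding Y_vec mX_def hX_def s_def ..
  finally have sum: "(\<Sum>t\<in>UNIV. cartan F t i j y * cartan_up F t r l y) = \<dots>" .
  have *: "4 * ?A\<^sup>2 * (\<Sum>t\<in>UNIV. cartan F t i j y * cartan_up F t r l y)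
     = 2 * ?A * (\<eta>' s * (h i j y * mX + m j y * hX i + m i y * hX j) + k'' s * (m i y * m j y) * mX)"
    unfolding sum using yD by (simp add: power2_eq_square)
  define E where "E = \<eta>' s * M s * h r l y + G s * (m r y * m l y)"
  have m2: "2 * ?A * mX = E / \<Delta> s"
    using yD nz(3) by (simp add: mX_eq E_def s_def field_simps)
  have h2: "2 * ?A * hX t = (Y t r l y - f0 s * f2 s * (E / \<Delta> s) * m t y) / \<eta> s" for t
    unfolding hX_eq m2[symmetric] using yD nz(2) by (simp add: s_def field_simps)
  have "4 * ?A\<^sup>2 * (\<Sum>t\<in>UNIV. cartan F t i j y * cartan_up F t r l y)
    = \<eta>' s * (h i j y * (2 * ?A * mX) + m j y * (2 * ?A * hX i) + m i y * (2 * ?A * hX j))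
      + k'' s * (m i y * m j y) * (2 * ?A * mX)"
    unfolding * by (simp add: algebra_simps)
  also have "\<dots> = \<eta>' s / \<eta> s * (Y i r l y * m j y + Y j r l y * m i y)
    - 2 * \<eta>' s * f0 s * f2 s / (\<eta> s * \<Delta> s) * (m i y * m j y) * E
    + (\<eta>' s * h i j y + k'' s * (m i y * m j y)) * E / \<Delta> s"
    unfolding m2 h2 using nz by (simp add: s_def[symmetric] field_simps)
  \<comment> \<open>The \<open>h\<close> part of \<open>E\<close> supplies the factor
    \<open>M * (f0 * f2) = \<Delta> - \<eta>\<close>, which splits
    \<open>1 / (\<eta> * \<Delta>)\<close> into a difference of reciprocals.\<close>
  also have "2 * \<eta>' s * f0 s * f2 s / (\<eta> s * \<Delta> s) * (m i y * m j y) * E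
    = (2 * (\<eta>' s)\<^sup>2 / \<eta> s - 2 * (\<eta>' s)\<^sup>2 / \<Delta> s) * (m i y * m j y * h r l y)
     + 2 * \<eta>' s * f0 s * f2 s * G s / (\<eta> s * \<Delta> s) * (m i y * m j y * (m r y * m l y))"
  proof -
    have "2 * (\<eta>' s)\<^sup>2 / \<eta> s - 2 * (\<eta>' s)\<^sup>2 / \<Delta> s = 2 * (\<eta>' s)\<^sup>2 * (\<Delta> s - \<eta> s) / (\<eta> s * \<Delta> s)"
      using nz by (simp add: s_def[symmetric] field_simps)
    also have "\<Delta> s - \<eta> s = M s * (f0 s * f2 s)" by (simp add: \<Delta>_def)
    finally show ?thesis
      using nz by (simp add: E_def s_def[symmetric] power2_eq_square field_simps)
  qed
  finally show ?thesis by (simp add: E_def)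
qed

definition \<Phi> :: "real \<Rightarrow> real" where
  "\<Phi> t = - f0 t * (t * \<eta>' t + (\<eta>' t)\<^sup>2 * M t / (2 * \<Delta> t))"

definition \<Psi> :: "real \<Rightarrow> real" where
  "\<Psi> t = - f0 t * t * k'' t + 2 * f1 t * \<eta>' t
     - f0 t / 2 * (2 * (\<eta>' t)\<^sup>2 / \<eta> t + \<eta>' t * G t / \<Delta> t)"

definition \<Omega> :: "real \<Rightarrow> real" where
  "\<Omega> t = f0 t * k''' t + 4 * f1 t * k'' t
     - 3 * f0 t / 2 * (2 * \<eta>' t * k'' t / \<eta> t - 2 * \<eta>' t * f0 t * f2 t * G t / (\<eta> t * \<Delta> t) + k'' t * G t / \<Delta> t)"

text \<open>The terms with \<open>n\<close> cancel between the derivative of the Cartan tensor and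
  its products with the gradient of \<open>F\<close>. In the quadratic terms, the parts with
  \<open>1 / \<eta>\<close> give each h m m from the two index pairings that separate the indices of
  \<open>h\<close>; the parts with \<open>1 / \<Delta>\<close> become symmetric because
  \<open>G = 2 * \<eta>' + k'' * M\<close>.\<close>

lemma T_tensor_eq:
  assumes y: "y \<in> ab_dom J a b" and inv: "invertible (fund_mat F y)"
    and nz: "f0 (ab_s a b y) \<noteq> 0" "\<eta> (ab_s a b y) \<noteq> 0" "\<Delta> (ab_s a b y) \<noteq> 0"
  defines "s \<equiv> ab_s a b y"
  shows "2 * alpha a y * T_tensor F r i j l y =
      \<Phi> s * (h r i y * h j l y + h r j y * h i l y + h r l y * h i j y)
      + \<Psi> s * (h r i y * (m j y * m l y) + h r j y * (m i y * m l y) + h r l y * (m i y * m j y)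
         + h i j y * (m r y * m l y) + h i l y * (m r y * m j y) + h j l y * (m r y * m i y))
      + \<Omega> s * (m r y * m i y * (m j y * m l y))"
proof -
  note yD = ab_domD[OF y]
  let ?A = "alpha a y"
  define C where "C i j r l = (\<Sum>t\<in>UNIV. cartan F t i j y * cartan_up F t r l y)" for i j r l
  define cd where "cd = cartan_dot F r i j l y"
  have T: "2 * ?A * T_tensor F r i j l y = f0 s * (2 * ?A\<^sup>2 * cd)
      - f0 s / 2 * (4 * ?A\<^sup>2 * C i j r l + 4 * ?A\<^sup>2 * C j r i l + 4 * ?A\<^sup>2 * C i r j l)
      + Y r i j y * (f0 s * n l y + f1 s * m l y) + Y r i l y * (f0 s * n j y + f1 s * m j y)
      + Y r j l y * (f0 s * n i y + f1 s * m i y) + Y i j l y * (f0 s * n r y + f1 s * m r y)"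
    unfolding T_tensor_def sum.distrib
    unfolding C_def[symmetric] cd_def[symmetric]
    unfolding partial_eqI[OF has_partial_F[OF y]] cartan_eq[OF y] ab_F_def[of f0 a b y] s_def[symmetric]
    using yD by (simp add: power2_eq_square field_simps)
  have cd: "2 * ?A\<^sup>2 * cd = - (n r y * Y i j l y + n i y * Y r j l y + n j y * Y r i l y + n l y * Y r i j y)
     - s * \<eta>' s * (h r i y * h j l y + h r j y * h i l y + h r l y * h i j y)
     - s * k'' s * (h r i y * (m j y * m l y) + h r j y * (m i y * m l y) + h r l y * (m i y * m j y)
         + h i j y * (m r y * m l y) + h i l y * (m r y * m j y) + h j l y * (m r y * m i y))
     + k''' s * (m r y * m i y * (m j y * m l y))"
    unfolding cd_def cartan_dot_eq[OF y] using yD by (simp add: s_def)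
  \<comment> \<open>Naming the quotients leaves a polynomial identity for the last step.\<close>
  define P1 where "P1 = \<eta>' s / \<eta> s"
  define P2 where "P2 = 2 * (\<eta>' s)\<^sup>2 / \<Delta> s"
  define P3 where "P3 = \<eta>' s * f0 s * f2 s * G s / (\<eta> s * \<Delta> s)"
  define x where "x = 1 / \<Delta> s"
  have C: "4 * ?A\<^sup>2 * C i j r l = P1 * (Y i r l y * m j y + Y j r l y * m i y)
    - (2 * P1 * \<eta>' s - 2 * x * (\<eta>' s)\<^sup>2) * (m i y * m j y * h r l y)
    - 2 * P3 * (m i y * m j y * (m r y * m l y))
    + x * (\<eta>' s * h i j y + k'' s * (m i y * m j y)) * (\<eta>' s * M s * h r l y + G s * (m r y * m l y))"
    for i j r l
    unfolding C_def cartan_up_contract[OF y inv nz]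
    by (simp add: P1_def P3_def x_def s_def power2_eq_square add_divide_distrib algebra_simps)
  have co: "\<Phi> s = - f0 s * (s * \<eta>' s + x * (\<eta>' s)\<^sup>2 * M s / 2)"
    "\<Psi> s = - f0 s * s * k'' s + 2 * f1 s * \<eta>' s - f0 s / 2 * (2 * P1 * \<eta>' s + x * \<eta>' s * G s)"
    "\<Omega> s = f0 s * k''' s + 4 * f1 s * k'' s - 3 * f0 s / 2 * (2 * P1 * k'' s - 2 * P3 + x * k'' s * G s)"
    by (simp_all add: \<Phi>_def \<Psi>_def \<Omega>_def P1_def P3_def x_def power2_eq_square)
  have G: "G s = 2 * \<eta>' s + k'' s * M s" by (rule G_def)
  have hs: "h i r y = h r i y" "h j r y = h r j y" "h l r y = h r l y" "h j i y = h i j y"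
    "h l i y = h i l y" "h l j y = h j l y"
    by (simp_all add: h_sym)
  show ?thesis
    unfolding T cd C co Y_def s_def[symmetric] hs
    by (simp add: G power2_eq_square algebra_simps)
qed

text \<open>A vector \<open>u\<close> annihilated by \<open>b\<close> and by \<open>n\<close>
  satisfies g u = \<eta> a u, so a zero of \<eta> would put it into the kernel of g.\<close>

lemma \<eta>_nonzero:
  assumes "CARD('n) \<ge> 3" and y: "y \<in> ab_dom J a b" and inv: "invertible (fund_mat F y)"
  shows "\<eta> (ab_s a b y) \<noteq> 0"
proof
  assume 0: "\<eta> (ab_s a b y) = 0"
  obtain u where u: "u \<noteq> 0" "b \<bullet> u = 0" "(a *v y) \<bullet> u = 0"
    using exists_orthogonal_to_pair[OF assms(1)] by blast
  have "(fund_mat F y *v u) $ i = 0" for i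
    using u by (simp add: matrix_vector_mult_def fund_mat_def fund_eq[OF y] g_vec n_inner m_inner 0 inner_commute)
  then have "fund_mat F y *v u = 0" by (simp add: vec_eq_iff)
  then have "u = 0"
    using inv by (metis invertible_left_inverse matrix_left_invertible_ker)
  then show False using u(1) by simp
qed

text \<open>The vector \<open>v\<close> constructed below satisfies g v = \<Delta> m. It is nonzero
  because its contraction with \<open>m\<close> is \<open>M\<close>, which is positive for
  \<open>s^2 < b^2\<close>.\<close>

lemma \<Delta>_nonzero:
  assumes y: "y \<in> ab_dom J a b" and inv: "invertible (fund_mat F y)"
    and nz: "f0 (ab_s a b y) \<noteq> 0" "(ab_s a b y)\<^sup>2 < bsq a b"
  shows "\<Delta> (ab_s a b y) \<noteq> 0"
proof
  let ?s = "ab_s a b y" and ?A = "alpha a y"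
  assume 0: "\<Delta> ?s = 0"
  note yD = ab_domD[OF y]
  \<comment> \<open>Chosen so that the contractions of \<open>v\<close> with \<open>n\<close> and
    \<open>m\<close>, weighted by \<open>f0\<close> and \<open>f1\<close>, add up to zero; this
    removes the \<open>n\<close> component of g v.\<close>
  define q where "q = M ?s * f1 ?s / (f0 ?s * ?A)"
  define v where "v = m_sharp y - q *\<^sub>R y"
  have sums: "(\<Sum>j\<in>UNIV. f j * v $ j) = (\<Sum>j\<in>UNIV. f j * m_sharp y $ j) - q * (\<Sum>j\<in>UNIV. f j * y $ j)" for f
    by (simp add: v_def sum_subtractf right_diff_distrib sum_distrib_left mult_ac)
  have nv: "(\<Sum>j\<in>UNIV. n j y * v $ j) = - (M ?s * f1 ?s / f0 ?s)"
    unfolding sums using yD by (simp add: n_y n_m_sharp q_def)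
  have mv: "(\<Sum>j\<in>UNIV. m j y * v $ j) = M ?s"
    unfolding sums using yD by (simp add: m_y m_m_sharp M_def)
  have hv: "(\<Sum>j\<in>UNIV. h i j y * v $ j) = m i y" for i
    unfolding sums using yD by (simp add: h_y h_m_sharp)
  have "(fund_mat F y *v v) $ i = 0" for i
  proof -
    have "(fund_mat F y *v v) $ i = m i y * \<Delta> ?s"
    proof -
      have "(fund_mat F y *v v) $ i = (\<Sum>j\<in>UNIV. g i j y * v $ j)"
        by (simp add: matrix_vector_mult_def fund_mat_def fund_eq[OF y])
      then show ?thesis
        unfolding g_vec nv mv hv using nz(1)
        by (simp add: k_def k'_def \<Delta>_def power2_eq_square field_simps)
    qed
    then show ?thesis by (simp add: 0)
  qed
  then have "fund_mat F y *v v = 0" by (simp add: vec_eq_iff)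
  then have "v = 0"
    using inv by (metis invertible_left_inverse matrix_left_invertible_ker)
  then show False using mv nz(2) by (simp add: M_def)
qed

text \<open>Each contraction with \<open>u\<close> kills \<open>m\<close> in that slot and turns
  \<open>h\<close> into \<open>w\<close>. Three contractions leave \<open>3 * q * w\<close> times
  \<Phi>, and \<open>w\<close> is nonzero.\<close>

lemma \<Phi>_zero_of_T_zero:
  assumes "CARD('n) \<ge> 3" and y: "y \<in> ab_dom J a b" and inv: "invertible (fund_mat F y)"
    and nz: "f0 (ab_s a b y) \<noteq> 0" "\<eta> (ab_s a b y) \<noteq> 0" "\<Delta> (ab_s a b y) \<noteq> 0"
    and T: "\<And>r i j l. T_tensor F r i j l y = 0"
  shows "\<Phi> (ab_s a b y) = 0"
proof -
  let ?s = "ab_s a b y"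
  obtain u where u: "u \<noteq> 0" "b \<bullet> u = 0" "(a *v y) \<bullet> u = 0"
    using exists_orthogonal_to_pair[OF assms(1)] by blast
  define w where "w = a *v u"
  have mu: "(\<Sum>i\<in>UNIV. m i y * u $ i) = 0"
    using u by (simp add: m_inner inner_commute)
  have hu: "(\<Sum>j\<in>UNIV. h i j y * u $ j) = w $ i" for i
    using u by (simp add: h_inner inner_commute w_def)
  define q where "q = (\<Sum>i\<in>UNIV. w $ i * u $ i)"
  have q: "q > 0"
    using posdef[OF u(1)] by (simp add: q_def w_def inner_vec_def mult.commute)
  have 0: "\<Phi> ?s * (h r i y * h j l y + h r j y * h i l y + h r l y * h i j y)
      + \<Psi> ?s * (h r i y * (m j y * m l y) + h r j y * (m i y * m l y) + h r l y * (m i y * m j y)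
         + h i j y * (m r y * m l y) + h i l y * (m r y * m j y) + h j l y * (m r y * m i y))
      + \<Omega> ?s * (m r y * m i y * (m j y * m l y)) = 0" for r i j l
    using T_tensor_eq[OF y inv nz, of r i j l] T[of r i j l] by simp
  have 1: "\<Phi> ?s * (h r i y * w $ j + h r j y * w $ i + w $ r * h i j y)
      + \<Psi> ?s * (w $ r * (m i y * m j y) + w $ i * (m r y * m j y) + w $ j * (m r y * m i y)) = 0" for r i j
  proof -
    have "(\<Sum>l\<in>UNIV. (\<Phi> ?s * (h r i y * h j l y + h r j y * h i l y + h r l y * h i j y)
      + \<Psi> ?s * (h r i y * (m j y * m l y) + h r j y * (m i y * m l y) + h r l y * (m i y * m j y)
         + h i j y * (m r y * m l y) + h i l y * (m r y * m j y) + h j l y * (m r y * m i y))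
      + \<Omega> ?s * (m r y * m i y * (m j y * m l y))) * u $ l)
     = \<Phi> ?s * (h r i y * (\<Sum>l\<in>UNIV. h j l y * u $ l) + h r j y * (\<Sum>l\<in>UNIV. h i l y * u $ l)
         + (\<Sum>l\<in>UNIV. h r l y * u $ l) * h i j y)
      + \<Psi> ?s * ((h r i y * m j y + h r j y * m i y + h i j y * m r y) * (\<Sum>l\<in>UNIV. m l y * u $ l)
         + (\<Sum>l\<in>UNIV. h r l y * u $ l) * (m i y * m j y)
         + (\<Sum>l\<in>UNIV. h i l y * u $ l) * (m r y * m j y) + (\<Sum>l\<in>UNIV. h j l y * u $ l) * (m r y * m i y))
      + \<Omega> ?s * (m r y * m i y * m j y * (\<Sum>l\<in>UNIV. m l y * u $ l))"
      by (simp add: sum.distrib sum_distrib_left sum_distrib_right algebra_simps)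
    then show ?thesis unfolding 0 hu mu by simp
  qed
  have 2: "\<Phi> ?s * (h r i y * q + 2 * w $ r * w $ i) + \<Psi> ?s * (q * (m r y * m i y)) = 0" for r i
  proof -
    have "(\<Sum>j\<in>UNIV. (\<Phi> ?s * (h r i y * w $ j + h r j y * w $ i + w $ r * h i j y)
      + \<Psi> ?s * (w $ r * (m i y * m j y) + w $ i * (m r y * m j y) + w $ j * (m r y * m i y))) * u $ j)
      = \<Phi> ?s * (h r i y * (\<Sum>j\<in>UNIV. w $ j * u $ j) + (\<Sum>j\<in>UNIV. h r j y * u $ j) * w $ i
          + w $ r * (\<Sum>j\<in>UNIV. h i j y * u $ j))
       + \<Psi> ?s * ((w $ r * m i y + w $ i * m r y) * (\<Sum>j\<in>UNIV. m j y * u $ j)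
          + (\<Sum>j\<in>UNIV. w $ j * u $ j) * (m r y * m i y))"
      by (simp add: sum.distrib sum_distrib_left sum_distrib_right algebra_simps)
    then show ?thesis unfolding 1 hu mu q_def[symmetric] by (simp add: algebra_simps)
  qed
  have 3: "\<Phi> ?s * (3 * q * w $ r) = 0" for r
  proof -
    have "(\<Sum>i\<in>UNIV. (\<Phi> ?s * (h r i y * q + 2 * w $ r * w $ i) + \<Psi> ?s * (q * (m r y * m i y))) * u $ i)
      = \<Phi> ?s * ((\<Sum>i\<in>UNIV. h r i y * u $ i) * q + 2 * w $ r * (\<Sum>i\<in>UNIV. w $ i * u $ i))
        + \<Psi> ?s * (q * m r y * (\<Sum>i\<in>UNIV. m i y * u $ i))"
      by (simp add: sum.distrib sum_distrib_left sum_distrib_right algebra_simps)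
    then show ?thesis unfolding 2 hu mu q_def[symmetric] by (simp add: algebra_simps)
  qed
  have "\<exists>r. w $ r \<noteq> 0"
    using q by (auto simp: q_def intro: ccontr)
  then show ?thesis using 3 q by auto
qed

lemma fund_const_imp_T_zero:
  assumes const: "\<And>z i j. z \<in> ab_dom J a b \<Longrightarrow> fund F i j z = q i j" and y: "y \<in> ab_dom J a b"
  shows "T_tensor F r i j l y = 0"
proof -
  note op = open_ab_dom[OF open_J]
  have C: "cartan F i j l z = 0" if z: "z \<in> ab_dom J a b" for i j l z
    using partial_eqI[OF has_partial_transform[OF op z const has_partial_const]]
    by (simp add: cartan_def)
  have "cartan_dot F r i j l y = 0"
    using partial_eqI[OF has_partial_transform[OF op y C has_partial_const]]
    by (simp add: cartan_dot_def)
  then show ?thesis by (simp add: T_tensor_def C[OF y])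
qed

end

section \<open>The differential equation for \<open>\<phi>\<close>\<close>

text \<open>Allows an identity that holds on an open set to be differentiated.\<close>

lemma DERIV_unique_on_open:
  fixes f g :: "real \<Rightarrow> real"
  assumes "open S" "t \<in> S" "\<And>u. u \<in> S \<Longrightarrow> f u = g u"
    and "(f has_real_derivative D) (at t)" "(g has_real_derivative E) (at t)"
  shows "D = E"
proof -
  have "(g has_real_derivative D) (at t)"
    by (rule has_field_derivative_transform_within_open[OF assms(4,1,2,3)])
  then show ?thesis using assms(5) by (rule DERIV_unique)
qed

text \<open>The set where \<open>f\<close> and \<open>g\<close> agree is closed relative to
  \<open>J\<close>, where continuity is known. This carries identities to \<open>s = 0\<close> and
  to the boundary values with \<open>s^2 = b^2\<close>.\<close>

lemma eq_on_closure:
  fixes f g :: "real \<Rightarrow> real"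
  assumes "continuous_on J f" "continuous_on J g" "S \<subseteq> J" "t \<in> J" "t \<in> closure S"
    and "\<And>u. u \<in> S \<Longrightarrow> f u = g u"
  shows "f t = g t"
proof -
  have "closedin (top_of_set J) {x \<in> J. f x - g x = 0}"
    by (intro continuous_closedin_preimage_constant continuous_on_diff assms(1,2))
  then obtain C where C: "closed C" "{x \<in> J. f x - g x = 0} = J \<inter> C"
    unfolding closedin_closed by blast
  have "S \<subseteq> C" using assms(3,6) C(2) by auto
  then have "t \<in> C" using assms(5) C(1) closure_minimal by blast
  then have "t \<in> {x \<in> J. f x - g x = 0}" using assms(4) C(2) by blast
  then show ?thesis by simp
qed

text \<open>The two zero sets are relatively closed, disjoint and cover \<open>S\<close>, so one of
  them is empty.\<close>

lemma connected_dichotomy: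
  fixes f g :: "'a::topological_space \<Rightarrow> real"
  assumes "connected S" "continuous_on S f" "continuous_on S g"
    and "\<And>t. t \<in> S \<Longrightarrow> f t = 0 \<or> g t = 0" "\<And>t. t \<in> S \<Longrightarrow> \<not> (f t = 0 \<and> g t = 0)"
  shows "(\<forall>t\<in>S. f t = 0) \<or> (\<forall>t\<in>S. g t = 0)"
proof -
  let ?E = "{t \<in> S. f t = 0}" and ?D = "{t \<in> S. g t = 0}"
  have "closedin (top_of_set S) ?E" "closedin (top_of_set S) ?D"
    by (intro continuous_closedin_preimage_constant assms)+
  moreover have "?E \<union> ?D = S" "?E \<inter> ?D = {}" using assms(4,5) by auto
  ultimately have "?E = {} \<or> ?D = {}"
    using assms(1) unfolding connected_closedin_eq by metis
  then show ?thesis using assms(4) by auto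
qed

section \<open>Consequences of the first-order equation for \<phi>\<close>

context ab_jet
begin

lemma \<eta>_factor: "\<eta> t = f0 t * (f0 t - t * f1 t)"
  by (simp add: \<eta>_def k_def power2_eq_square algebra_simps)

lemma deriv_M: "(M has_real_derivative - 2 * t) (at t)"
  unfolding M_def[abs_def] by (auto intro!: derivative_eq_intros)

text \<open>The equation \<open>M (\<phi> - s\<phi>') / \<phi> = 1 / c\<close>, cleared of
  denominators. The set is a parameter because the two sides of \<open>s = 0\<close> are treated
  separately.\<close>

definition solves :: "real \<Rightarrow> real set \<Rightarrow> bool" where
  "solves c S \<longleftrightarrow> (\<forall>t\<in>S. f0 t = c * M t * (f0 t - t * f1 t))"

context
  fixes S :: "real set" and c :: real
  assumes S: "open S" "S \<subseteq> J" "\<And>t. t \<in> S \<Longrightarrow> t \<noteq> 0" "\<And>t. t \<in> S \<Longrightarrow> M t > 0"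
    and c: "c \<noteq> 0" and sol: "solves c S"
begin

text \<open>Along a solution, \<open>\<eta>'\<close>, \<open>k''\<close>, \<open>k'''\<close> and \<open>\<Delta>\<close> are \<open>W\<close> times rational functions of \<open>t\<close>, \<open>M\<close>
  and \<open>lam\<close>, obtained by differentiating \<open>\<eta> = lam f0\<^sup>2\<close> repeatedly.\<close>

definition lam :: "real \<Rightarrow> real" where "lam t = 1 / (c * M t)"
definition W :: "real \<Rightarrow> real" where "W t = (c * bsq a b - 1) * (lam t)\<^sup>2 * (f0 t)\<^sup>2"
definition \<tau> :: "real \<Rightarrow> real" where "\<tau> t = t\<^sup>2 / M t"
definition R :: "real \<Rightarrow> real" where "R t = 2 * lam t - 1 - 4 * \<tau> t"

lemma solves_\<psi>: "t \<in> S \<Longrightarrow> f0 t - t * f1 t = lam t * f0 t"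
  using sol S(4)[of t] c by (auto simp: solves_def lam_def field_simps)

lemma solves_f1: "t \<in> S \<Longrightarrow> t * f1 t = f0 t * (1 - lam t)"
  using solves_\<psi>[of t] by (simp add: algebra_simps)

lemma solves_\<eta>: "t \<in> S \<Longrightarrow> \<eta> t = lam t * (f0 t)\<^sup>2"
  by (simp add: \<eta>_factor solves_\<psi> power2_eq_square)

text \<open>Gives \<open>W\<close> a second form: the constant factor on the left suits
  differentiation, the right-hand side suits comparison with the other functions.\<close>

lemma kappa_lam: "t \<in> S \<Longrightarrow> (c * bsq a b - 1) * lam t = 1 + \<tau> t - lam t"
proof -
  assume t: "t \<in> S"
  have "bsq a b = M t + t\<^sup>2" by (simp add: M_def)
  then show ?thesis using S(4)[OF t] c by (simp add: lam_def \<tau>_def field_simps)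
qed

lemma deriv_lam: "t \<in> S \<Longrightarrow> (lam has_real_derivative 2 * t * lam t / M t) (at t)"
  unfolding lam_def[abs_def] using S(4)[of t] c
  by (intro DERIV_cong[OF DERIV_divide[OF DERIV_const DERIV_cmult[OF deriv_M]]])
     (auto simp: field_simps power2_eq_square)

lemma deriv_\<tau>: "t \<in> S \<Longrightarrow> (\<tau> has_real_derivative 2 * t / M t + 2 * t ^ 3 / (M t)\<^sup>2) (at t)"
proof -
  assume t: "t \<in> S"
  have "((\<lambda>u. u\<^sup>2) has_real_derivative 2 * t) (at t)"
    by (auto intro!: derivative_eq_intros)
  from DERIV_divide[OF this deriv_M] S(4)[OF t]
  have "(\<tau> has_real_derivative (2 * t * M t - t\<^sup>2 * (- 2 * t)) / (M t * M t)) (at t)"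
    unfolding \<tau>_def[abs_def] by simp
  then show ?thesis
    by (rule DERIV_cong) (use S(4)[OF t] in \<open>simp add: field_simps power2_eq_square power3_eq_cube\<close>)
qed

lemma solves_\<eta>': "t \<in> S \<Longrightarrow> t * \<eta>' t = 2 * W t"
proof -
  assume t: "t \<in> S"
  then have J: "t \<in> J" using S(2) by blast
  have "\<eta>' t = 2 * t * lam t / M t * (f0 t)\<^sup>2 + 2 * lam t * f0 t * f1 t"
    by (rule DERIV_unique_on_open[OF S(1) t solves_\<eta> deriv_\<eta>[OF J]])
       (auto intro!: derivative_eq_intros deriv_lam deriv_f0 t J)
  then have "t * \<eta>' t = 2 * lam t * (f0 t)\<^sup>2 * \<tau> t + 2 * lam t * f0 t * (t * f1 t)"
    by (simp add: \<tau>_def power2_eq_square algebra_simps)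
  also have "\<dots> = 2 * lam t * (f0 t)\<^sup>2 * (1 + \<tau> t - lam t)"
    unfolding solves_f1[OF t] by (simp add: power2_eq_square algebra_simps)
  also have "\<dots> = 2 * W t"
    unfolding kappa_lam[OF t, symmetric] by (simp add: W_def power2_eq_square)
  finally show ?thesis .
qed

text \<open>The logarithmic derivative of \<open>W\<close> is twice that of \<open>lam\<close> plus
  twice that of \<open>f0\<close>, that is,
  \<open>4 * t / M t + 2 * (1 - lam t) / t\<close>.\<close>

lemma deriv_W: "t \<in> S \<Longrightarrow> (W has_real_derivative W t * (4 * \<tau> t + 2 - 2 * lam t) / t) (at t)"
proof -
  assume t: "t \<in> S"
  then have J: "t \<in> J" using S(2) by blast
  let ?D = "(c * bsq a b - 1) * (2 * lam t * (2 * t * lam t / M t) * (f0 t)\<^sup>2 + (lam t)\<^sup>2 * (2 * f0 t * f1 t))"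
  have "((\<lambda>t. (lam t)\<^sup>2 * (f0 t)\<^sup>2) has_real_derivative
      2 * lam t * (2 * t * lam t / M t) * (f0 t)\<^sup>2 + (lam t)\<^sup>2 * (2 * f0 t * f1 t)) (at t)"
    by (auto intro!: derivative_eq_intros deriv_lam deriv_f0 t J simp: algebra_simps)
  then have "(W has_real_derivative ?D) (at t)"
    unfolding W_def[abs_def] mult.assoc[of "c * bsq a b - 1"] by (rule DERIV_cmult)
  moreover have "t * ?D = W t * (4 * \<tau> t + 2 - 2 * lam t)"
  proof -
    have "t * (q * (2 * lam t * (2 * t * lam t / M t) * (f0 t)\<^sup>2 + (lam t)\<^sup>2 * (2 * f0 t * f1 t)))
      = q * (4 * (lam t)\<^sup>2 * \<tau> t * (f0 t)\<^sup>2 + 2 * (lam t)\<^sup>2 * f0 t * (t * f1 t))" for q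
      by (simp add: \<tau>_def power2_eq_square algebra_simps)
    then have "t * ?D = (c * bsq a b - 1) * (4 * (lam t)\<^sup>2 * \<tau> t * (f0 t)\<^sup>2 + 2 * (lam t)\<^sup>2 * f0 t * (t * f1 t))" .
    then show ?thesis unfolding solves_f1[OF t] by (simp add: W_def power2_eq_square algebra_simps)
  qed
  then have "?D = W t * (4 * \<tau> t + 2 - 2 * lam t) / t"
    using S(3)[OF t] by (simp add: eq_divide_eq mult.commute)
  ultimately show ?thesis by simp
qed

text \<open>Obtained by differentiating \<open>t * \<eta>' t = 2 * W t\<close>, as
  \<open>\<eta>'\<close> has derivative \<open>- t * k'' t\<close>.\<close>

lemma solves_k'': "t \<in> S \<Longrightarrow> t ^ 3 * k'' t = 2 * W t * R t"
proof -
  assume t: "t \<in> S"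
  then have J: "t \<in> J" using S(2) by blast
  have "\<eta>' t + t * (- t * k'' t) = 2 * (W t * (4 * \<tau> t + 2 - 2 * lam t) / t)"
    by (rule DERIV_unique_on_open[OF S(1) t solves_\<eta>'])
       (auto intro!: derivative_eq_intros deriv_\<eta>' deriv_W t J)
  then have "t * (\<eta>' t + t * (- t * k'' t)) = 2 * (W t * (4 * \<tau> t + 2 - 2 * lam t))"
    using S(3)[OF t] by simp
  then have "t * \<eta>' t - t ^ 3 * k'' t = 2 * (W t * (4 * \<tau> t + 2 - 2 * lam t))"
    by (simp add: power3_eq_cube algebra_simps)
  then show ?thesis
    unfolding solves_\<eta>'[OF t] by (simp add: R_def algebra_simps)
qed

text \<open>Obtained by differentiating the previous identity. The power \<open>t ^ 3\<close> lowers
  the 2 in the logarithmic derivative of \<open>W\<close> to -1, and the terms without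
  \<open>R\<close> are \<open>t\<close> times the derivative of \<open>R\<close>.\<close>

lemma solves_k''': "t \<in> S \<Longrightarrow> t ^ 4 * k''' t =
  2 * W t * ((4 * \<tau> t - 1 - 2 * lam t) * R t + 4 * lam t * \<tau> t - 8 * \<tau> t - 8 * (\<tau> t)\<^sup>2)"
proof -
  assume t: "t \<in> S"
  then have J: "t \<in> J" using S(2) by blast
  have dR: "(R has_real_derivative 4 * t * lam t / M t - 4 * (2 * t / M t + 2 * t ^ 3 / (M t)\<^sup>2)) (at t)"
    unfolding R_def[abs_def]
    by (auto intro!: derivative_eq_intros deriv_lam deriv_\<tau> t)
  have "3 * t\<^sup>2 * k'' t + t ^ 3 * k''' t = 2 * (W t * (4 * \<tau> t + 2 - 2 * lam t) / t) * R t
      + 2 * W t * (4 * t * lam t / M t - 4 * (2 * t / M t + 2 * t ^ 3 / (M t)\<^sup>2))"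
    by (rule DERIV_unique_on_open[OF S(1) t solves_k''])
       (auto intro!: derivative_eq_intros deriv_k'' dR deriv_W t J)
  then have "t * (3 * t\<^sup>2 * k'' t + t ^ 3 * k''' t) = t * (2 * (W t * (4 * \<tau> t + 2 - 2 * lam t) / t) * R t
      + 2 * W t * (4 * t * lam t / M t - 4 * (2 * t / M t + 2 * t ^ 3 / (M t)\<^sup>2)))"
    by simp
  moreover have "t * (3 * t\<^sup>2 * k'' t + t ^ 3 * k''' t) = 3 * (t ^ 3 * k'' t) + t ^ 4 * k''' t"
    by (simp add: power2_eq_square power3_eq_cube power4_eq_xxxx algebra_simps)
  moreover have "t * (2 * (W t * (4 * \<tau> t + 2 - 2 * lam t) / t) * R t
      + 2 * W t * (4 * t * lam t / M t - 4 * (2 * t / M t + 2 * t ^ 3 / (M t)\<^sup>2)))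
     = 2 * W t * (4 * \<tau> t + 2 - 2 * lam t) * R t + 2 * W t * (4 * lam t * \<tau> t - 8 * \<tau> t - 8 * (\<tau> t)\<^sup>2)"
    using S(3)[OF t] S(4)[OF t]
    by (simp add: \<tau>_def power2_eq_square power3_eq_cube field_simps)
  ultimately show ?thesis
    unfolding solves_k''[OF t] by (simp add: algebra_simps)
qed

lemma solves_f0f2: "t \<in> S \<Longrightarrow> t\<^sup>2 * (f0 t * f2 t) = lam t * (1 - lam t) * (f0 t)\<^sup>2 - 2 * W t"
proof -
  assume t: "t \<in> S"
  have "t\<^sup>2 * (f0 t * f2 t) = (t * f1 t) * (f0 t - t * f1 t) - t * \<eta>' t"
    by (simp add: \<eta>'_def k_def k'_def power2_eq_square algebra_simps)
  then show ?thesis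
    unfolding solves_\<eta>'[OF t] solves_\<psi>[OF t] unfolding solves_f1[OF t]
    by (simp add: power2_eq_square algebra_simps)
qed

lemma W_alt: "t \<in> S \<Longrightarrow> W t = (1 + \<tau> t - lam t) * (lam t * (f0 t)\<^sup>2)"
  unfolding kappa_lam[symmetric] by (simp add: W_def power2_eq_square)

text \<open>Equivalent to \<open>2 * t * \<Delta> t + \<eta>' t * M t = 0\<close>, the second factor
  of \<Phi>. It also shows that a nonzero \<Delta> forces \<open>W\<close>, hence
  \<open>c * bsq a b - 1\<close>, to be nonzero.\<close>

lemma solves_\<Delta>: "t \<in> S \<Longrightarrow> t\<^sup>2 * \<Delta> t = - W t * M t"
proof -
  assume t: "t \<in> S"
  have "t\<^sup>2 * \<Delta> t = t\<^sup>2 * \<eta> t + M t * (t\<^sup>2 * (f0 t * f2 t))"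
    by (simp add: \<Delta>_def algebra_simps)
  also have "\<dots> = lam t * (f0 t)\<^sup>2 * (t\<^sup>2 + M t * (1 - lam t)) - 2 * W t * M t"
    unfolding solves_f0f2[OF t] solves_\<eta>[OF t] by (simp add: algebra_simps)
  also have "t\<^sup>2 + M t * (1 - lam t) = M t * (1 + \<tau> t - lam t)"
    using S(4)[OF t] by (simp add: \<tau>_def field_simps)
  also have "lam t * (f0 t)\<^sup>2 * (M t * (1 + \<tau> t - lam t)) = W t * M t"
    unfolding W_alt[OF t] by (simp add: algebra_simps)
  finally show ?thesis by simp
qed

lemma solves_imp_nonsingular: "t \<in> S \<Longrightarrow> \<Delta> t \<noteq> 0 \<Longrightarrow> W t \<noteq> 0 \<and> \<eta>' t \<noteq> 0 \<and> c * bsq a b \<noteq> 1"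
  using solves_\<Delta>[of t] S(3)[of t] solves_\<eta>'[of t] by (auto simp: W_def)

text \<open>\<Delta> is proportional to \<open>W\<close>, so dividing by it cancels one factor
  \<open>W\<close>. Then \<Psi> and \<Omega> are \<open>f0 * W\<close> over a power of
  \<open>t\<close>, times a polynomial in \<open>lam\<close> and \<tau> that vanishes
  identically.\<close>

lemma solves_imp_zero:
  assumes t: "t \<in> S" and nz: "\<Delta> t \<noteq> 0" "f0 t \<noteq> 0"
  shows "\<Phi> t = 0" "\<Psi> t = 0" "\<Omega> t = 0"
proof -
  have W: "W t \<noteq> 0" using solves_imp_nonsingular[OF t nz(1)] by blast
  have t0: "t \<noteq> 0" and M0: "M t \<noteq> 0" using S(3,4)[OF t] by auto
  define l where "l = lam t"
  have l0: "l \<noteq> 0" using M0 c by (simp add: l_def lam_def)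
  define K where "K = 1 + \<tau> t - l"
  have Weq: "W t = K * (l * (f0 t)\<^sup>2)" using W_alt[OF t] by (simp add: K_def l_def)
  have K0: "K \<noteq> 0" using W Weq by auto
  have e1: "\<eta>' t = 2 * W t / t" using solves_\<eta>'[OF t] t0 by (simp add: field_simps)
  have e2: "k'' t = 2 * W t * R t / t ^ 3" using solves_k''[OF t] t0 by (simp add: field_simps)
  have e3: "k''' t = 2 * W t * ((4 * \<tau> t - 1 - 2 * l) * R t + 4 * l * \<tau> t - 8 * \<tau> t - 8 * (\<tau> t)\<^sup>2) / t ^ 4"
    using solves_k'''[OF t] t0 by (simp add: l_def field_simps)
  have D: "\<Delta> t = - W t * M t / t\<^sup>2" using solves_\<Delta>[OF t] t0 by (simp add: field_simps)
  have e1D: "\<eta>' t / \<Delta> t = - 2 * t / M t"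
    unfolding e1 D using W t0 M0 by (simp add: power2_eq_square field_simps)
  have e2D: "k'' t / \<Delta> t = - 2 * R t / (t * M t)"
    unfolding e2 D using W t0 M0 by (simp add: power2_eq_square power3_eq_cube field_simps)
  have ratio: "\<eta>' t / \<eta> t = 2 * K / t"
    unfolding e1 solves_\<eta>[OF t] Weq l_def[symmetric] using l0 nz t0 by (simp add: field_simps)
  have f02: "f0 t * f2 t / \<eta> t = (1 - l - 2 * K) / t\<^sup>2"
  proof -
    have "f0 t * f2 t = (l * (1 - l) * (f0 t)\<^sup>2 - 2 * (K * (l * (f0 t)\<^sup>2))) / t\<^sup>2"
      using solves_f0f2[OF t] t0 by (simp add: Weq l_def field_simps)
    then show ?thesis
      unfolding solves_\<eta>[OF t] l_def[symmetric] using l0 nz t0 by (simp add: field_simps)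
  qed
  have f1: "f1 t = f0 t * (1 - l) / t" using solves_f1[OF t] t0 by (simp add: l_def field_simps)
  \<comment> \<open>The ratios \<open>e1D\<close> and \<open>e2D\<close> carry \<open>1 / M\<close>,
    which is absorbed here into \<open>G\<close>.\<close>
  have MG: "G t / M t = 2 * W t * (2 * \<tau> t + R t) / t ^ 3"
    unfolding G_def e1 e2 using t0 M0
    by (simp add: \<tau>_def power2_eq_square power3_eq_cube field_simps)
  have "\<Phi> t = - f0 t * (t * \<eta>' t + \<eta>' t * (\<eta>' t / \<Delta> t) * M t / 2)"
    by (simp add: \<Phi>_def power2_eq_square)
  then show "\<Phi> t = 0" unfolding e1D using M0 by simp
  have RR: "R t = 2 * l - 1 - 4 * \<tau> t" by (simp add: R_def l_def)
  have "\<Psi> t = - f0 t * t * k'' t + 2 * f1 t * \<eta>' t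
     - f0 t / 2 * (2 * \<eta>' t * (\<eta>' t / \<eta> t) + (\<eta>' t / \<Delta> t) * G t)"
    by (simp add: \<Psi>_def power2_eq_square)
  also have "(\<eta>' t / \<Delta> t) * G t = - 2 * t * (G t / M t)" unfolding e1D by simp
  also have "- f0 t * t * k'' t + 2 * f1 t * \<eta>' t
     - f0 t / 2 * (2 * \<eta>' t * (\<eta>' t / \<eta> t) + - 2 * t * (G t / M t)) = 2 * f0 t * W t / t\<^sup>2 * (- R t + 2 * (1 - l) - 2 * K + (2 * \<tau> t + R t))"
    unfolding ratio MG unfolding e1 e2 f1 using t0
    by (simp add: power2_eq_square power3_eq_cube field_simps)
  finally show "\<Psi> t = 0" by (simp add: K_def)
  have "\<Omega> t = f0 t * k''' t + 4 * f1 t * k'' t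
     - 3 * f0 t / 2 * (2 * (\<eta>' t / \<eta> t) * k'' t - 2 * (\<eta>' t / \<Delta> t) * (f0 t * f2 t / \<eta> t) * G t
        + (k'' t / \<Delta> t) * G t)"
    by (simp add: \<Omega>_def mult_ac)
  also have "2 * (\<eta>' t / \<Delta> t) * (f0 t * f2 t / \<eta> t) * G t = - 4 * t * (f0 t * f2 t / \<eta> t) * (G t / M t)"
    unfolding e1D by simp
  also have "(k'' t / \<Delta> t) * G t = - 2 * R t / t * (G t / M t)"
    unfolding e2D by simp
  also have "f0 t * k''' t + 4 * f1 t * k'' t
     - 3 * f0 t / 2 * (2 * (\<eta>' t / \<eta> t) * k'' t - - 4 * t * (f0 t * f2 t / \<eta> t) * (G t / M t)
        + - 2 * R t / t * (G t / M t)) = 2 * f0 t * W t / t ^ 4 * ((4 * \<tau> t - 1 - 2 * l) * R t + 4 * l * \<tau> t - 8 * \<tau> t - 8 * (\<tau> t)\<^sup>2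
      + 4 * (1 - l) * R t - 3 / 2 * (4 * K * R t + 4 * (1 - l - 2 * K) * (2 * \<tau> t + R t) - 2 * R t * (2 * \<tau> t + R t)))"
    unfolding ratio f02 MG e2 e3 f1 using t0
    by (simp add: power2_eq_square power3_eq_cube power4_eq_xxxx field_simps)
  also have "(4 * \<tau> t - 1 - 2 * l) * R t + 4 * l * \<tau> t - 8 * \<tau> t - 8 * (\<tau> t)\<^sup>2
      + 4 * (1 - l) * R t - 3 / 2 * (4 * K * R t + 4 * (1 - l - 2 * K) * (2 * \<tau> t + R t) - 2 * R t * (2 * \<tau> t + R t)) = 0"
    unfolding RR K_def by (simp add: power2_eq_square field_simps)
  finally show "\<Omega> t = 0" by simp
qed

end

end

section \<open>One tangent space under the regularity hypotheses\<close>

locale ab_regular = ab_jet a b J f0 f1 f2 f3 f4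
  for a :: "real ^ 'n::finite ^ 'n" and b :: "real ^ 'n" and J f0 f1 f2 f3 f4 +
  fixes b0 :: real
  assumes dim: "CARD('n) \<ge> 3"
    and J_cases: "J = {-b0<..<b0} \<or> J = {0<..<b0}"
    and b_le: "sqrt (bsq a b) \<le> b0"
    and f0_pos: "t \<in> J \<Longrightarrow> f0 t > 0"
    and convex: "t \<in> J \<Longrightarrow> \<bar>t\<bar> < x \<Longrightarrow> x < b0 \<Longrightarrow>
      f0 t - t * f1 t + (x\<^sup>2 - t\<^sup>2) * f2 t > 0"
    and inv: "y \<in> ab_dom J a b \<Longrightarrow> invertible (fund_mat F y)"
begin

definition rad :: real where "rad = sqrt (bsq a b)"

text \<open>The values that \<open>s\<close> takes on \<open>ab_dom_star\<close> in this tangent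
  space, as \<open>I_attained\<close> and \<open>ab_dom_star_I\<close> confirm.\<close>

definition I :: "real set" where "I = {t \<in> J. t\<^sup>2 < bsq a b}"

lemma rad_pos: "rad > 0" using bsq_pos by (simp add: rad_def)

lemma sq_less_iff: "t\<^sup>2 < bsq a b \<longleftrightarrow> \<bar>t\<bar> < rad"
  unfolding rad_def using real_sqrt_less_iff[of "t\<^sup>2" "bsq a b"] by simp

lemma I_eq: "I = (if 0 \<in> J then {-rad<..<rad} else {0<..<rad})"
  using J_cases b_le rad_pos unfolding I_def sq_less_iff rad_def[symmetric] by (auto split: if_splits)

lemma pos_part: "{0<..<rad} \<subseteq> I"
  using rad_pos by (auto simp: I_eq)

lemma M_pos: "t \<in> I \<Longrightarrow> M t > 0"
  by (simp add: I_def M_def)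

lemma I_in_J: "t \<in> I \<Longrightarrow> t \<in> J"
  by (simp add: I_def)

lemma I_attained:
  assumes "t \<in> I"
  obtains y where "y \<in> ab_dom J a b" "ab_s a b y = t" "y \<in> ab_dom_star J a b"
proof -
  obtain y where "y \<noteq> 0" "ab_s a b y = t"
    using ab_s_surj[OF dim] assms unfolding I_def by blast
  then show thesis
    using assms that[of y] by (auto simp: ab_dom_star_iff ab_dom_def I_def)
qed

lemma ab_dom_star_I: "y \<in> ab_dom_star J a b \<longleftrightarrow> y \<noteq> 0 \<and> ab_s a b y \<in> I"
  by (auto simp: ab_dom_star_iff ab_dom_def I_def)

text \<open>Letting \<open>x\<close> decrease to \<open>\<bar>t\<bar>\<close> in the convexity
  hypothesis gives \<open>f0 t - t * f1 t \<ge> 0\<close>; nondegeneracy makes the inequality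
  strict.\<close>

lemma \<eta>_pos: "t \<in> I \<Longrightarrow> \<eta> t > 0"
proof -
  assume t: "t \<in> I"
  then have J: "t \<in> J" "\<bar>t\<bar> < b0" using J_cases by (auto simp: I_def)
  obtain y where y: "y \<in> ab_dom J a b" "ab_s a b y = t" using I_attained[OF t] by blast
  have "((\<lambda>x. f0 t - t * f1 t + (x\<^sup>2 - t\<^sup>2) * f2 t) \<longlongrightarrow> f0 t - t * f1 t + (\<bar>t\<bar>\<^sup>2 - t\<^sup>2) * f2 t) (at_right \<bar>t\<bar>)"
    by (intro tendsto_intros)
  moreover have "\<forall>\<^sub>F x in at_right \<bar>t\<bar>. 0 \<le> f0 t - t * f1 t + (x\<^sup>2 - t\<^sup>2) * f2 t"
    unfolding eventually_at_right_field using convex[OF J(1)] J(2) less_imp_le by blast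
  ultimately have "0 \<le> f0 t - t * f1 t + (\<bar>t\<bar>\<^sup>2 - t\<^sup>2) * f2 t"
    by (rule tendsto_lowerbound) simp
  then have "\<eta> t \<ge> 0" using f0_pos[OF J(1)] by (simp add: \<eta>_factor)
  moreover have "\<eta> t \<noteq> 0" using \<eta>_nonzero[OF dim y(1) inv[OF y(1)]] y(2) by simp
  ultimately show ?thesis by simp
qed

lemma \<Delta>_nz: "t \<in> I \<Longrightarrow> \<Delta> t \<noteq> 0"
proof -
  assume t: "t \<in> I"
  obtain y where y: "y \<in> ab_dom J a b" "ab_s a b y = t" using I_attained[OF t] by blast
  then show ?thesis
    using \<Delta>_nonzero[OF y(1) inv[OF y(1)]] t f0_pos[of t] by (auto simp: I_def)
qed

lemma T_zero_imp_\<Phi>_zero: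
  assumes "\<And>y r i j l. y \<in> ab_dom_star J a b \<Longrightarrow> T_tensor F r i j l y = 0" and t: "t \<in> I"
  shows "\<Phi> t = 0"
proof -
  obtain y where y: "y \<in> ab_dom J a b" "ab_s a b y = t" "y \<in> ab_dom_star J a b"
    using I_attained[OF t] by blast
  show ?thesis
    using \<Phi>_zero_of_T_zero[OF dim y(1) inv[OF y(1)]] f0_pos[OF I_in_J[OF t]] \<eta>_pos[OF t] \<Delta>_nz[OF t]
      assms(1)[OF y(3)] y(2) by auto
qed

lemma coefficients_zero_imp_T_zero:
  assumes "\<And>t. t \<in> I \<Longrightarrow> \<Phi> t = 0 \<and> \<Psi> t = 0 \<and> \<Omega> t = 0" and y: "y \<in> ab_dom_star J a b"
  shows "T_tensor F r i j l y = 0"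
proof -
  have t: "ab_s a b y \<in> I" and y': "y \<in> ab_dom J a b"
    using y by (auto simp: ab_dom_star_I ab_dom_def I_def)
  have "2 * alpha a y * T_tensor F r i j l y = 0"
    using T_tensor_eq[OF y' inv[OF y'], of r i j l] assms(1)[OF t] f0_pos[OF I_in_J[OF t]]
      \<eta>_pos[OF t] \<Delta>_nz[OF t] by simp
  then show ?thesis using ab_domD[OF y'] by simp
qed

section \<open>From the vanishing of \<Phi> to the two alternatives\<close>

lemma continuous_on_J:
  "continuous_on J f0" "continuous_on J f1" "continuous_on J f2" "continuous_on J k" "continuous_on J k'"
  "continuous_on J k''" "continuous_on J \<eta>" "continuous_on J \<eta>'" "continuous_on J M"
  by (auto intro!: continuous_at_imp_continuous_on DERIV_isCont deriv_f0 deriv_f1 deriv_f2 deriv_k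
      deriv_k' deriv_k'' deriv_\<eta> deriv_\<eta>' deriv_M)

text \<open>The vanishing of \<open>\<Phi>\<close> factors as \<open>\<eta>' (2 t \<Delta> + \<eta>' M) = 0\<close>. The second factor is, up to sign
  and a factor \<open>f0\<^sup>2\<close>, the derivative of \<open>M (f0 - t f1) / f0\<close>; the factors have no common zero
  except at \<open>t = 0\<close>.\<close>

lemma \<Phi>_zero_dichotomy:
  assumes S: "S = {l<..<u}" "S \<subseteq> I" "0 \<notin> S" "S \<noteq> {}" and \<Phi>: "\<And>t. t \<in> S \<Longrightarrow> \<Phi> t = 0"
  shows "(\<forall>t\<in>S. \<eta>' t = 0) \<or> (\<exists>c>0. solves c S)"
proof -
  define e where "e t = 2 * t * \<Delta> t + \<eta>' t * M t" for t
  have SJ: "S \<subseteq> J" using S(2) by (auto simp: I_def)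
  have "(\<forall>t\<in>S. \<eta>' t = 0) \<or> (\<forall>t\<in>S. e t = 0)"
  proof (rule connected_dichotomy)
    show "connected S" by (simp add: S(1))
    show "continuous_on S \<eta>'" using continuous_on_J(8) SJ by (rule continuous_on_subset)
    have "continuous_on J e"
      unfolding e_def \<Delta>_def by (intro continuous_intros continuous_on_J)
    then show "continuous_on S e" using SJ by (rule continuous_on_subset)
    fix t assume t: "t \<in> S"
    then have tI: "t \<in> I" using S(2) by blast
    note nz = \<Delta>_nz[OF tI] f0_pos[OF I_in_J[OF tI]] M_pos[OF tI]
    have "f0 t * (t * \<eta>' t + (\<eta>' t)\<^sup>2 * M t / (2 * \<Delta> t)) = 0"
      using \<Phi>[OF t] by (simp add: \<Phi>_def)
    then have "t * \<eta>' t + (\<eta>' t)\<^sup>2 * M t / (2 * \<Delta> t) = 0" using nz(2) by simp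
    then have "\<eta>' t * e t = 0"
      using nz(1) by (simp add: e_def power2_eq_square field_simps)
    then show "\<eta>' t = 0 \<or> e t = 0" by simp
    show "\<not> (\<eta>' t = 0 \<and> e t = 0)"
      using nz(1) t S(3) by (auto simp: e_def)
  qed
  moreover have "\<exists>c>0. solves c S" if e0: "\<forall>t\<in>S. e t = 0"
  proof -
    define Q where "Q t = M t * (f0 t - t * f1 t) / f0 t" for t
    have dQ: "(Q has_real_derivative 0) (at t)" if t: "t \<in> S" for t
    proof -
      have J: "t \<in> J" using t SJ by blast
      have f0: "f0 t \<noteq> 0" using f0_pos[OF J] by simp
      have "((\<lambda>t. M t * (f0 t - t * f1 t)) has_real_derivative
          - 2 * t * (f0 t - t * f1 t) + M t * (- t * f2 t)) (at t)"
        by (auto intro!: derivative_eq_intros deriv_M deriv_f0 deriv_f1 J simp: algebra_simps)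
      from DERIV_divide[OF this deriv_f0[OF J] f0]
      have "(Q has_real_derivative ((- 2 * t * (f0 t - t * f1 t) + M t * (- t * f2 t)) * f0 t
          - M t * (f0 t - t * f1 t) * f1 t) / (f0 t * f0 t)) (at t)"
        unfolding Q_def[abs_def] .
      moreover have "(- 2 * t * (f0 t - t * f1 t) + M t * (- t * f2 t)) * f0 t
          - M t * (f0 t - t * f1 t) * f1 t = - e t"
        unfolding e_def \<Delta>_def \<eta>_factor
        by (simp add: \<eta>'_def k_def k'_def power2_eq_square algebra_simps)
      ultimately show ?thesis using e0 t by simp
    qed
    have "convex S" by (simp add: S(1))
    then have "\<exists>q. \<forall>t\<in>S. Q t = q"
      by (rule has_field_derivative_zero_constant) (use dQ has_field_derivative_at_within in blast)
    then obtain q where q: "\<And>t. t \<in> S \<Longrightarrow> Q t = q" by blast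
    obtain t0 where t0: "t0 \<in> S" using S(4) by blast
    have \<psi>: "f0 t - t * f1 t > 0" "f0 t > 0" "M t > 0" if "t \<in> S" for t
    proof -
      have "t \<in> I" using that S(2) by blast
      then show "f0 t > 0" "M t > 0" using f0_pos I_in_J M_pos by blast+
      then show "f0 t - t * f1 t > 0"
        using \<eta>_pos[OF \<open>t \<in> I\<close>] by (simp add: \<eta>_factor zero_less_mult_iff)
    qed
    \<comment> \<open>Positivity of \<eta>, \<open>f0\<close> and \<open>M\<close> fixes the sign of
      the constant, whose inverse serves as \<open>c\<close>.\<close>
    have "Q t0 > 0" using \<psi>[OF t0] by (simp add: Q_def)
    then have q0: "q > 0" using q[OF t0] by simp
    have "f0 t = 1 / q * M t * (f0 t - t * f1 t)" if t: "t \<in> S" for t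
      using q[OF t] q0 \<psi>[OF t] by (simp add: Q_def field_simps)
    then have "solves (1 / q) S" by (simp add: solves_def)
    then show ?thesis using q0 by (intro exI[of _ "1 / q"]) simp
  qed
  ultimately show ?thesis by blast
qed

lemma solves_nonsingular:
  assumes "open S" "S \<subseteq> I" "0 \<notin> S" "c \<noteq> 0" "solves c S" "t \<in> S"
  shows "\<eta>' t \<noteq> 0" "c * bsq a b \<noteq> 1"
proof -
  have "S \<subseteq> J" "\<And>t. t \<in> S \<Longrightarrow> t \<noteq> 0" "\<And>t. t \<in> S \<Longrightarrow> M t > 0" "\<Delta> t \<noteq> 0"
    using assms I_in_J M_pos \<Delta>_nz by blast+
  then show "\<eta>' t \<noteq> 0" "c * bsq a b \<noteq> 1"
    using solves_imp_nonsingular assms by blast+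
qed

text \<open>By continuity the equation would persist at 0, where it reads
  \<open>f0 0 = c * bsq a b * f0 0\<close>; but \<open>c * bsq a b = 1\<close> makes \<Delta>
  vanish.\<close>

lemma solves_excludes_zero:
  assumes "open S" "S \<subseteq> I" "0 \<notin> S" "c \<noteq> 0" "solves c S" "0 \<in> closure S"
  shows "0 \<notin> J"
proof
  assume 0: "0 \<in> J"
  have SJ: "S \<subseteq> J" using assms(2) I_in_J by blast
  have "f0 0 = c * M 0 * (f0 0 - 0 * f1 0)"
  proof (rule eq_on_closure[OF continuous_on_J(1) _ SJ 0 assms(6)])
    show "continuous_on J (\<lambda>t. c * M t * (f0 t - t * f1 t))"
      by (intro continuous_intros continuous_on_J)
    show "f0 u = c * M u * (f0 u - u * f1 u)" if "u \<in> S" for u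
      using that assms(5) by (simp add: solves_def)
  qed
  then have "c * bsq a b = 1" using f0_pos[OF 0] by (simp add: M_def)
  moreover obtain t where "t \<in> S" using assms(6) by fastforce
  ultimately show False using solves_nonsingular(2)[OF assms(1-5)] by blast
qed

text \<open>A solution excludes \<open>0 \<in> J\<close>, so \<open>I\<close> is only its positive
  half and the equation holds on all of it.\<close>

lemma solves_imp_T_zero:
  assumes "c \<noteq> 0" "solves c {0<..<rad}" "y \<in> ab_dom_star J a b"
  shows "T_tensor F r i j l y = 0"
proof -
  have "0 \<notin> J"
    by (rule solves_excludes_zero[OF _ pos_part _ assms(1,2)]) (use rad_pos in auto)
  then have I: "I = {0<..<rad}" by (simp add: I_eq)
  have "\<Phi> t = 0 \<and> \<Psi> t = 0 \<and> \<Omega> t = 0" if "t \<in> I" for t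
  proof -
    have "S \<subseteq> J \<and> (\<forall>t\<in>S. t \<noteq> 0 \<and> M t > 0)" if "S = {0<..<rad}" for S
      using that I I_in_J M_pos by auto
    then have *: "{0<..<rad} \<subseteq> J" "\<And>t. t \<in> {0<..<rad} \<Longrightarrow> t \<noteq> 0" "\<And>t. t \<in> {0<..<rad} \<Longrightarrow> M t > 0"
      by blast+
    show ?thesis
      using solves_imp_zero[OF open_greaterThanLessThan * assms(1,2)] that \<Delta>_nz[OF that]
        f0_pos[OF I_in_J[OF that]] unfolding I by auto
  qed
  then show ?thesis using coefficients_zero_imp_T_zero assms(3) by blast
qed

text \<open>Since \<eta> is a constant \<open>p\<close>, its second derivative
  \<open>- t * k'' t\<close> vanishes and \<open>k'\<close> is a constant \<open>q\<close>. Then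
  \<open>f0^2 = p + q * t^2\<close>, and the square of \<open>F\<close> is quadratic in
  \<open>y\<close>.\<close>

lemma \<eta>_const_imp_quadratic:
  assumes 0: "\<And>t. t \<in> I \<Longrightarrow> t \<noteq> 0 \<Longrightarrow> \<eta>' t = 0"
  obtains p q where "\<And>y i j. y \<in> ab_dom J a b \<Longrightarrow> fund F i j y = p * a $ i $ j + q * (b $ i * b $ j)"
proof -
  have IJ: "I \<subseteq> J" using I_in_J by blast
  have openI: "open I" and convI: "convex I" by (auto simp: I_eq)
  have pos_closure: "0 \<in> closure {0<..<rad}" using rad_pos by simp
  have \<eta>'0: "\<eta>' t = 0" if t: "t \<in> I" for t
  proof (cases "t = 0")
    case True
    have "\<eta>' 0 = 0"
      by (rule eq_on_closure[where g = "\<lambda>_. 0" and J = J and S = "{0<..<rad}", OF continuous_on_J(8)])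
         (use t True 0 pos_part IJ pos_closure in auto)
    then show ?thesis using True by simp
  qed (use 0 t in blast)
  have k''nz: "k'' t = 0" if t: "t \<in> I" "t \<noteq> 0" for t
  proof -
    have "- t * k'' t = 0"
      by (rule DERIV_unique_on_open[OF openI t(1), where f = \<eta>' and g = "\<lambda>_. 0"])
         (use \<eta>'0 deriv_\<eta>' I_in_J t in auto)
    then show ?thesis using t(2) by simp
  qed
  have k''0: "k'' t = 0" if t: "t \<in> I" for t
  proof (cases "t = 0")
    case True
    have "k'' 0 = 0"
      by (rule eq_on_closure[where g = "\<lambda>_. 0" and J = J and S = "{0<..<rad}", OF continuous_on_J(6)])
         (use t True k''nz pos_part IJ pos_closure in auto)
    then show ?thesis using True by simp
  qed (use k''nz t in blast)
  have "\<exists>q. \<forall>t\<in>I. k' t = q"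
  proof (rule has_field_derivative_zero_constant[OF convI])
    show "(k' has_real_derivative 0) (at t within I)" if "t \<in> I" for t
      using deriv_k'[of t] k''0[OF that] I_in_J[OF that] has_field_derivative_at_within by metis
  qed
  then obtain q where q: "\<And>t. t \<in> I \<Longrightarrow> k' t = q" by blast
  have "\<exists>p. \<forall>t\<in>I. \<eta> t = p"
  proof (rule has_field_derivative_zero_constant[OF convI])
    show "(\<eta> has_real_derivative 0) (at t within I)" if "t \<in> I" for t
      using deriv_\<eta>[of t] \<eta>'0[OF that] I_in_J[OF that] has_field_derivative_at_within by metis
  qed
  then obtain p where p: "\<And>t. t \<in> I \<Longrightarrow> \<eta> t = p" by blast
  have kI: "k t = t * q" if "t \<in> I" for t
    using \<eta>'0[OF that] q[OF that] by (simp add: \<eta>'_def)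
  have cl: "t \<in> closure I" if "t \<in> J" "t\<^sup>2 \<le> bsq a b" for t
  proof -
    have "\<bar>t\<bar> \<le> rad"
      using real_sqrt_le_mono[OF that(2)] by (simp add: rad_def)
    then show ?thesis
      using that(1) J_cases rad_pos by (auto simp: I_eq)
  qed
  have "fund F i j y = p * a $ i $ j + q * (b $ i * b $ j)" if y: "y \<in> ab_dom J a b" for y i j
  proof -
    note yD = ab_domD[OF y]
    let ?s = "ab_s a b y"
    have c: "?s \<in> closure I" using cl yD ab_s_le by blast
    have e1: "k ?s = ?s * q"
      by (rule eq_on_closure[OF continuous_on_J(4) _ IJ yD(2) c]) (auto intro!: continuous_intros kI)
    have e2: "\<eta> ?s = p"
      by (rule eq_on_closure[OF continuous_on_J(7) _ IJ yD(2) c]) (auto intro!: continuous_intros p)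
    \<comment> \<open>\<open>k'\<close> is compared with \<open>q\<close> only inside
      \<open>I\<close>; at \<open>s^2 = b^2\<close> the covector \<open>m\<close> vanishes.\<close>
    have e3: "k' ?s * (m i y * m j y) = q * (m i y * m j y)"
    proof (cases "?s\<^sup>2 < bsq a b")
      case True
      then show ?thesis using q[of ?s] yD(2) by (simp add: I_def)
    next
      case False
      then show ?thesis using m_nonzero_iff[OF yD(1)] by simp
    qed
    have e4: "(f0 ?s)\<^sup>2 = p + ?s * (?s * q)" using e1 e2 by (simp add: \<eta>_def)
    have b: "b $ l = m l y + ?s * n l y" for l by (simp add: m_def)
    show ?thesis
      unfolding fund_eq[OF y] g_def e1 e2 e3 e4 b by (simp add: h_def algebra_simps)
  qed
  then show thesis using that by blast
qed

section \<open>The closed form of the solutions\<close>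

definition profile :: "real \<Rightarrow> real \<Rightarrow> real" where
  "profile c t = t powr ((c * bsq a b - 1) / (c * bsq a b)) * (c * bsq a b - c * t\<^sup>2) powr (1 / (2 * c * bsq a b))"

lemma profile_pos: "c > 0 \<Longrightarrow> t \<in> {0<..<rad} \<Longrightarrow> profile c t > 0"
  using pos_part M_pos[of t] by (auto simp: profile_def M_def right_diff_distrib[symmetric])

text \<open>The equation \<open>solves\<close> prescribes the logarithmic derivative
  \<open>(1 - 1 / (c * M t)) / t\<close>, and the two powers integrate its partial
  fractions.\<close>

lemma deriv_profile:
  assumes "c > 0" "t \<in> {0<..<rad}"
  shows "(profile c has_real_derivative profile c t * ((1 - 1 / (c * M t)) / t)) (at t)"
proof -
  let ?B = "bsq a b"
  define e1 where "e1 = (c * ?B - 1) / (c * ?B)"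
  define e2 where "e2 = 1 / (2 * c * ?B)"
  have t: "t > 0" "M t > 0" using assms(2) pos_part M_pos by auto
  have cM: "c * ?B - c * t\<^sup>2 = c * M t" by (simp add: M_def algebra_simps)
  have d1: "((\<lambda>t. t powr e1) has_real_derivative e1 * t powr (e1 - 1)) (at t)"
    using t(1) by (rule has_real_derivative_powr)
  have "((\<lambda>t. c * ?B - c * t\<^sup>2) has_real_derivative - 2 * c * t) (at t)"
    by (auto intro!: derivative_eq_intros)
  moreover have "((\<lambda>u. u powr e2) has_real_derivative e2 * (c * M t) powr (e2 - 1)) (at (c * ?B - c * t\<^sup>2))"
    unfolding cM using t(2) assms(1) by (intro has_real_derivative_powr) simp
  ultimately have d2: "((\<lambda>t. (c * ?B - c * t\<^sup>2) powr e2) has_real_derivative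
      e2 * (c * M t) powr (e2 - 1) * (- 2 * c * t)) (at t)"
    by (rule DERIV_chain2[rotated])
  have "(profile c has_real_derivative e1 * t powr (e1 - 1) * (c * M t) powr e2
      + e2 * (c * M t) powr (e2 - 1) * (- 2 * c * t) * t powr e1) (at t)"
    using DERIV_mult[OF d1 d2] unfolding profile_def[abs_def] e1_def[symmetric] e2_def[symmetric] cM .
  moreover have pw: "t powr (e1 - 1) = t powr e1 / t" "(c * M t) powr (e2 - 1) = (c * M t) powr e2 / (c * M t)"
    using t assms(1) by (simp_all add: powr_diff)
  moreover have pr: "profile c t = t powr e1 * (c * M t) powr e2"
    by (simp add: profile_def e1_def e2_def cM)
  \<comment> \<open>Rests on the decomposition
    \<open>1 / (t * M t) = 1 / (N * t) + t / (N * M t)\<close> with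
    \<open>N = bsq a b\<close>.\<close>
  moreover have ex: "e1 / t - 2 * c * t * e2 / (c * M t) = (1 - 1 / (c * M t)) / t"
  proof -
    define N where "N = M t + t\<^sup>2"
    have N: "N > 0" using t by (simp add: N_def add_pos_pos)
    have "?B = N" by (simp add: N_def M_def)
    then have "e1 = 1 - 1 / (c * N)" "2 * c * e2 = 1 / N"
      using assms(1) N unfolding e1_def e2_def by (simp_all add: field_simps)
    moreover have "(1 - 1 / (c * N)) / t - t * (1 / N) / (c * M t) = (1 - 1 / (c * M t)) / t"
      using t assms(1) N by (simp add: divide_simps) (simp add: N_def power2_eq_square algebra_simps)
    ultimately show ?thesis by (metis mult.assoc mult.commute)
  qed
  moreover have "e1 * (A / t) * C + e2 * (C / (c * M t)) * (- 2 * c * t) * A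
      = A * C * (e1 / t - 2 * c * t * e2 / (c * M t))" for A C
    by (simp add: right_diff_distrib mult_ac)
  ultimately show ?thesis by simp
qed

text \<open>Both functions have the same logarithmic derivative, so their quotient is constant on
  the interval.\<close>

lemma solves_imp_profile:
  assumes c: "c > 0" and sol: "solves c {0<..<rad}"
  obtains c3 where "\<And>t. t \<in> {0<..<rad} \<Longrightarrow> f0 t = c3 * profile c t"
proof -
  let ?S = "{0<..<rad}"
  have "\<exists>q. \<forall>t\<in>?S. f0 t / profile c t = q"
  proof (rule has_field_derivative_zero_constant)
    show "convex ?S" by simp
    fix t assume t: "t \<in> ?S"
    have tI: "t \<in> I" using t pos_part by blast
    have "f0 t = c * M t * (f0 t - t * f1 t)" using sol t by (simp add: solves_def)
    then have "f1 t = f0 t * ((1 - 1 / (c * M t)) / t)"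
      using c M_pos[OF tI] t by (simp add: field_simps)
    then have "((\<lambda>t. f0 t / profile c t) has_real_derivative 0) (at t)"
      using DERIV_divide[OF deriv_f0[OF I_in_J[OF tI]] deriv_profile[OF c t]] profile_pos[OF c t]
      by (simp add: algebra_simps)
    then show "((\<lambda>t. f0 t / profile c t) has_real_derivative 0) (at t within ?S)"
      by (rule has_field_derivative_at_within)
  qed
  then obtain q where q: "\<And>t. t \<in> ?S \<Longrightarrow> f0 t / profile c t = q" by blast
  have "f0 t = q * profile c t" if t: "t \<in> ?S" for t
    using q[OF t] profile_pos[OF c t] by (simp add: field_simps)
  then show thesis using that by blast
qed

lemma profile_imp_solves:
  assumes c: "c > 0" and eq: "\<And>t. t \<in> {0<..<rad} \<Longrightarrow> f0 t = c3 * profile c t"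
  shows "solves c {0<..<rad}"
  unfolding solves_def
proof
  fix t assume t: "t \<in> {0<..<rad}"
  have tI: "t \<in> I" using t pos_part by blast
  have "f1 t = c3 * (profile c t * ((1 - 1 / (c * M t)) / t))"
    by (rule DERIV_unique_on_open[OF open_greaterThanLessThan t eq deriv_f0[OF I_in_J[OF tI]]
          DERIV_cmult[OF deriv_profile[OF c t]]])
  then have "f1 t = f0 t * ((1 - 1 / (c * M t)) / t)" using eq[OF t] by simp
  then show "f0 t = c * M t * (f0 t - t * f1 t)"
    using c M_pos[OF tI] t by (simp add: field_simps)
qed

text \<open>The dichotomy is applied to each half of \<open>I\<close>. A solution on the positive
  half rules out \<open>0 \<in> J\<close>. A negative half exists only if \<open>0 \<in> J\<close>,
  and then it carries no solution, so \<open>\<eta>'\<close> vanishes there.\<close>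

lemma T_zero_cases:
  assumes "\<And>y r i j l. y \<in> ab_dom_star J a b \<Longrightarrow> T_tensor F r i j l y = 0"
  obtains (profile) c where "c > 0" "solves c {0<..<rad}" "0 \<notin> J"
    | (quadratic) "\<And>t. t \<in> I \<Longrightarrow> t \<noteq> 0 \<Longrightarrow> \<eta>' t = 0"
proof -
  have \<Phi>: "\<Phi> t = 0" if "t \<in> I" for t using T_zero_imp_\<Phi>_zero assms that by blast
  have "(\<forall>t\<in>{0<..<rad}. \<eta>' t = 0) \<or> (\<exists>c>0. solves c {0<..<rad})"
    by (rule \<Phi>_zero_dichotomy[OF refl pos_part]) (use \<Phi> pos_part rad_pos in auto)
  then consider c where "c > 0" "solves c {0<..<rad}" | "\<And>t. t \<in> {0<..<rad} \<Longrightarrow> \<eta>' t = 0"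
    by blast
  then show thesis
  proof cases
    case 1
    have "0 \<notin> J"
      by (rule solves_excludes_zero[OF _ pos_part _ _ 1(2)]) (use rad_pos 1(1) in auto)
    then show ?thesis using 1 profile by blast
  next
    case 2
    have neg: "\<eta>' t = 0" if t: "t \<in> I" "t < 0" for t
    proof -
      have 0: "0 \<in> J" and tr: "t \<in> {-rad<..<0}" using t by (auto simp: I_eq split: if_splits)
      have sub: "{-rad<..<0} \<subseteq> I" using 0 rad_pos by (auto simp: I_eq)
      have "(\<forall>t\<in>{-rad<..<0}. \<eta>' t = 0) \<or> (\<exists>c>0. solves c {-rad<..<0})"
        by (rule \<Phi>_zero_dichotomy[OF refl sub]) (use \<Phi> sub rad_pos in auto)
      moreover have False if "c > 0" "solves c {-rad<..<0}" for c
        using solves_excludes_zero[OF open_greaterThanLessThan sub _ _ that(2)] that(1) 0 rad_pos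
        by auto
      ultimately show ?thesis using tr by blast
    qed
    have "\<eta>' t = 0" if "t \<in> I" "t \<noteq> 0" for t
    proof (cases "t > 0")
      case True
      then show ?thesis using that 2 by (auto simp: I_eq split: if_splits)
    qed (use neg that in simp)
    then show ?thesis using quadratic by blast
  qed
qed

end

section \<open>The characterization on the manifold\<close>

lemma riemannian_metric_ab_tangent:
  assumes "riemannian_metric \<A> a" "\<kappa> \<in> \<A>" "p \<in> fst \<kappa>" "b \<noteq> 0"
  shows "ab_tangent (a \<kappa> p) b"
proof
  fix i j show "a \<kappa> p $ i $ j = a \<kappa> p $ j $ i"
    using assms unfolding riemannian_metric_def by blast
next
  fix v :: "real ^ 'b" assume "v \<noteq> 0"
  then have "(\<Sum>i\<in>UNIV. \<Sum>j\<in>UNIV. a \<kappa> p $ i $ j * v $ i * v $ j) > 0"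
    using assms unfolding riemannian_metric_def by blast
  then show "v \<bullet> (a \<kappa> p *v v) > 0"
    by (simp add: inner_vec_def matrix_vector_mult_def sum_distrib_left mult_ac)
qed (use assms in blast)

theorem theorem4p1:
  fixes \<A> :: "('m::{t2_space, second_countable_topology}, 'n::finite) chart set"
    and a :: "('m, 'n) chart \<Rightarrow> 'm \<Rightarrow> real ^ 'n ^ 'n"
    and b :: "('m, 'n) chart \<Rightarrow> 'm \<Rightarrow> real ^ 'n"
    and b0 :: real and J :: "real set" and \<phi> :: "real \<Rightarrow> real"
  assumes "smooth_atlas \<A>"
    and "CARD('n) \<ge> 3"
    and "riemannian_metric \<A> a"
    and "one_form \<A> b"
    and beta_nowhere_zero: "\<forall>\<kappa>\<in>\<A>. \<forall>p\<in>fst \<kappa>. b \<kappa> p \<noteq> 0"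
    and "b0 > 0"
    and "J = {-b0<..<b0} \<or> J = {0<..<b0}"
    and "smooth_on J \<phi>"
    and "\<forall>\<kappa>\<in>\<A>. \<forall>p\<in>fst \<kappa>. sqrt (bsq (a \<kappa> p) (b \<kappa> p)) \<le> b0"
    and "\<forall>t\<in>J. \<phi> t > 0"
    and "\<forall>t\<in>J. \<forall>x. \<bar>t\<bar> < x \<and> x < b0 \<longrightarrow>
           \<phi> t - t * deriv \<phi> t + (x\<^sup>2 - t\<^sup>2) * deriv (deriv \<phi>) t > 0"
    and nondegenerate: "\<forall>\<kappa>\<in>\<A>. \<forall>p\<in>fst \<kappa>. \<forall>y\<in>ab_dom J (a \<kappa> p) (b \<kappa> p).
           invertible (fund_mat (ab_F \<phi> (a \<kappa> p) (b \<kappa> p)) y)"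
  shows "T_condition \<A> a b J \<phi> \<longleftrightarrow>
    F_riemannian \<A> a b J \<phi> \<or>
    (\<exists>c c3. c \<noteq> 0 \<and>
      (\<forall>\<kappa>\<in>\<A>. \<forall>p\<in>fst \<kappa>. \<forall>y\<in>ab_dom_star J (a \<kappa> p) (b \<kappa> p).
        let s = ab_s (a \<kappa> p) (b \<kappa> p) y; B = bsq (a \<kappa> p) (b \<kappa> p) in
        s > 0 \<longrightarrow>
          c * B - c * s\<^sup>2 > 0 \<and>
          \<phi> s = c3 * s powr ((c * B - 1) / (c * B)) * (c * B - c * s\<^sup>2) powr (1 / (2 * c * B))))"
    (is "?T \<longleftrightarrow> ?R \<or> ?P")
proof -
  have openJ: "open J" using assms(7) by auto
  define f1 f2 f3 f4 where "f1 = deriv \<phi>" and "f2 = deriv f1" and "f3 = deriv f2" and "f4 = deriv f3"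
  note smooth = assms(8) smooth_on_real_deriv(2)[OF openJ]
  have sm: "smooth_on J f1" "smooth_on J f2" "smooth_on J f3"
    unfolding f1_def f2_def f3_def by (intro smooth)+
  note D = smooth_on_real_deriv(1)[OF openJ]
  have reg: "ab_regular (a \<kappa> p) (b \<kappa> p) J \<phi> f1 f2 f3 f4 b0" if "\<kappa> \<in> \<A>" "p \<in> fst \<kappa>" for \<kappa> p
  proof -
    have "b \<kappa> p \<noteq> 0" using that beta_nowhere_zero by blast
    then interpret ab_tangent "a \<kappa> p" "b \<kappa> p"
      using riemannian_metric_ab_tangent[OF assms(3) that] by blast
    show ?thesis
    proof
      fix t assume t: "t \<in> J"
      show "(\<phi> has_real_derivative f1 t) (at t)" "(f1 has_real_derivative f2 t) (at t)"
        "(f2 has_real_derivative f3 t) (at t)" "(f3 has_real_derivative f4 t) (at t)"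
        using D[OF assms(8) t] D[OF sm(1) t] D[OF sm(2) t] D[OF sm(3) t]
        by (simp_all add: f1_def f2_def f3_def f4_def)
      show "\<phi> t > 0" using assms(10) t by blast
      show "\<phi> t - t * f1 t + (x\<^sup>2 - t\<^sup>2) * f2 t > 0" if "\<bar>t\<bar> < x" "x < b0" for x
        using assms(11) t that by (simp add: f1_def f2_def)
    next
      show "sqrt (bsq (a \<kappa> p) (b \<kappa> p)) \<le> b0" using assms(9) that by blast
      show "invertible (fund_mat (ab_F \<phi> (a \<kappa> p) (b \<kappa> p)) y)"
        if "y \<in> ab_dom J (a \<kappa> p) (b \<kappa> p)" for y
        using nondegenerate that \<open>\<kappa> \<in> \<A>\<close> \<open>p \<in> fst \<kappa>\<close> by blast
    qed (use openJ assms(2,7) in auto)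
  qed
  \<comment> \<open>The case distinction asks whether the equation holds at some point of the
    manifold; if so, it is transferred to every other point.\<close>
  have "?R \<or> ?P" if T: ?T
  proof (cases "\<exists>\<kappa>\<in>\<A>. \<exists>p\<in>fst \<kappa>. \<exists>c>0. ab_jet.solves (a \<kappa> p) (b \<kappa> p) \<phi> f1 c {0<..<ab_regular.rad (a \<kappa> p) (b \<kappa> p)} \<and> 0 \<notin> J")
    case True
    then obtain \<kappa>0 p0 c where Q0: "\<kappa>0 \<in> \<A>" "p0 \<in> fst \<kappa>0" and c: "c > 0"
      and sol: "ab_jet.solves (a \<kappa>0 p0) (b \<kappa>0 p0) \<phi> f1 c {0<..<ab_regular.rad (a \<kappa>0 p0) (b \<kappa>0 p0)}"
      and J0: "0 \<notin> J" by blast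
    interpret Q0: ab_regular "a \<kappa>0 p0" "b \<kappa>0 p0" J \<phi> f1 f2 f3 f4 b0 by (rule reg[OF Q0])
    obtain c3 where c3: "\<And>t. t \<in> {0<..<Q0.rad} \<Longrightarrow> \<phi> t = c3 * Q0.profile c t"
      using Q0.solves_imp_profile[OF c sol] by blast
    have same: "bsq (a \<kappa> p) (b \<kappa> p) = bsq (a \<kappa>0 p0) (b \<kappa>0 p0)" if Q: "\<kappa> \<in> \<A>" "p \<in> fst \<kappa>" for \<kappa> p
    proof -
      interpret Q: ab_regular "a \<kappa> p" "b \<kappa> p" J \<phi> f1 f2 f3 f4 b0 by (rule reg[OF Q])
      \<comment> \<open>Both \<open>t\<close> and \<open>t / 2\<close> lie in the ranges of the two
        points. Subtracting the values of \<open>c * M\<close> there eliminates \<open>b^2\<close>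
        and yields \<open>c = c'\<close>, after which the values of \<open>b^2\<close>
        agree.\<close>
      define t where "t = min Q.rad Q0.rad / 2"
      have t: "t \<in> {0<..<Q0.rad}" "t \<in> {0<..<Q.rad}" "t / 2 \<in> {0<..<Q0.rad}" "t / 2 \<in> {0<..<Q.rad}"
        using Q.rad_pos Q0.rad_pos by (auto simp: t_def min_def)
      have T0: "T_tensor Q.F r i j l y = 0" if "y \<in> ab_dom_star J (a \<kappa> p) (b \<kappa> p)" for r i j l y
        using T that Q unfolding T_condition_def by blast
      show ?thesis
      proof (rule Q.T_zero_cases)
        show "T_tensor Q.F r i j l y = 0" if "y \<in> ab_dom_star J (a \<kappa> p) (b \<kappa> p)" for r i j l y
          by (rule T0[OF that])
      next
        fix c' assume c': "c' > 0" "Q.solves c' {0<..<Q.rad}"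
        \<comment> \<open>The ratio of \<phi> to \<open>\<phi> - u\<phi>'\<close> does not depend on
          the point of the manifold, and \<open>\<phi> u > 0\<close> permits the
          cancellation.\<close>
        have eq: "c * Q0.M u = c' * Q.M u" if u: "u \<in> {0<..<Q0.rad}" "u \<in> {0<..<Q.rad}" for u
        proof -
          have "\<phi> u = c * Q0.M u * (\<phi> u - u * f1 u)" using sol u(1) by (simp add: Q0.solves_def)
          moreover have "\<phi> u = c' * Q.M u * (\<phi> u - u * f1 u)" using c'(2) u(2) by (simp add: Q.solves_def)
          moreover have "\<phi> u > 0" using Q0.f0_pos Q0.I_in_J Q0.pos_part u(1) by blast
          ultimately show ?thesis by (metis mult_cancel_right mult_zero_right less_irrefl)
        qed
        have "c * Q0.M t - c * Q0.M (t / 2) = c' * Q.M t - c' * Q.M (t / 2)"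
          using eq[OF t(1,2)] eq[OF t(3,4)] by simp
        moreover have "c * Q0.M t - c * Q0.M (t / 2) = c * (- 3 / 4 * t\<^sup>2)"
          "c' * Q.M t - c' * Q.M (t / 2) = c' * (- 3 / 4 * t\<^sup>2)"
          by (simp_all add: Q0.M_def Q.M_def power_divide algebra_simps)
        ultimately have "c = c'" using t(1) by simp
        then show ?thesis using eq[OF t(1,2)] c by (simp add: Q0.M_def Q.M_def)
      next
        assume *: "\<And>t. t \<in> Q.I \<Longrightarrow> t \<noteq> 0 \<Longrightarrow> Q.\<eta>' t = 0"
        \<comment> \<open>\<open>\<eta>'\<close> depends on \<phi> alone, so both interpretations
          give the same number at \<open>t\<close>.\<close>
        have "Q.\<eta>' t = 0" using *[of t] t(2) Q.pos_part by auto
        moreover have "Q0.\<eta>' t \<noteq> 0"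
          using Q0.solves_nonsingular(1)[OF open_greaterThanLessThan Q0.pos_part _ _ sol t(1)] c by simp
        ultimately show ?thesis by simp
      qed
    qed
    have ?P
    proof (rule exI[of _ c], rule exI[of _ c3], intro conjI ballI)
      fix \<kappa> p y
      assume Q: "\<kappa> \<in> \<A>" "p \<in> fst \<kappa>" and y: "y \<in> ab_dom_star J (a \<kappa> p) (b \<kappa> p)"
      interpret Q: ab_regular "a \<kappa> p" "b \<kappa> p" J \<phi> f1 f2 f3 f4 b0 by (rule reg[OF Q])
      let ?s = "ab_s (a \<kappa> p) (b \<kappa> p) y"
      have s: "?s \<in> Q.I" using y by (simp add: Q.ab_dom_star_I)
      \<comment> \<open>\<open>0 \<notin> J\<close> leaves only positive values of \<open>s\<close>,
        and constancy of \<open>b^2\<close> makes the two ranges equal.\<close>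
      then have "?s \<in> {0<..<Q0.rad}"
        using J0 by (simp add: Q.I_eq Q.rad_def Q0.rad_def same[OF Q])
      then have "\<phi> ?s = c3 * Q0.profile c ?s" by (rule c3)
      moreover have "c * bsq (a \<kappa> p) (b \<kappa> p) - c * ?s\<^sup>2 > 0"
        using c s by (simp add: Q.I_def)
      ultimately show "let s = ?s; B = bsq (a \<kappa> p) (b \<kappa> p) in s > 0 \<longrightarrow>
          c * B - c * s\<^sup>2 > 0 \<and>
          \<phi> s = c3 * s powr ((c * B - 1) / (c * B)) * (c * B - c * s\<^sup>2) powr (1 / (2 * c * B))"
        by (simp add: Q0.profile_def same[OF Q] Let_def mult.assoc)
    qed (use c in simp)
    then show ?thesis ..
  next
    case False
    have ?R
      unfolding F_riemannian_def
    proof (intro ballI allI)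
      fix \<kappa> p y z i j
      assume Q: "\<kappa> \<in> \<A>" "p \<in> fst \<kappa>"
        and yz: "y \<in> ab_dom J (a \<kappa> p) (b \<kappa> p)" "z \<in> ab_dom J (a \<kappa> p) (b \<kappa> p)"
      interpret Q: ab_regular "a \<kappa> p" "b \<kappa> p" J \<phi> f1 f2 f3 f4 b0 by (rule reg[OF Q])
      show "fund Q.F i j y = fund Q.F i j z"
      proof (rule Q.T_zero_cases)
        show "T_tensor Q.F r i j l y = 0" if "y \<in> ab_dom_star J (a \<kappa> p) (b \<kappa> p)" for r i j l y
          using T that Q unfolding T_condition_def by blast
      next
        fix c assume "c > 0" "Q.solves c {0<..<Q.rad}" "0 \<notin> J"
        then show ?thesis using False Q by blast
      next
        assume "\<And>t. t \<in> Q.I \<Longrightarrow> t \<noteq> 0 \<Longrightarrow> Q.\<eta>' t = 0"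
        then show ?thesis using Q.\<eta>_const_imp_quadratic yz by metis
      qed
    qed
    then show ?thesis ..
  qed
  moreover have ?T if R: ?R
    unfolding T_condition_def
  proof (intro ballI allI)
    fix \<kappa> p y h i j k
    assume Q: "\<kappa> \<in> \<A>" "p \<in> fst \<kappa>" and y: "y \<in> ab_dom_star J (a \<kappa> p) (b \<kappa> p)"
    interpret Q: ab_regular "a \<kappa> p" "b \<kappa> p" J \<phi> f1 f2 f3 f4 b0 by (rule reg[OF Q])
    have y': "y \<in> ab_dom J (a \<kappa> p) (b \<kappa> p)" using y by (simp add: ab_dom_star_def)
    show "T_tensor Q.F h i j k y = 0"
      \<comment> \<open>The values of the fundamental tensor at \<open>y\<close> itself serve as the
        constants.\<close>
      by (rule Q.fund_const_imp_T_zero[OF _ y', where q = "\<lambda>i j. fund Q.F i j y"])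
         (use R Q y' in \<open>unfold F_riemannian_def, blast\<close>)
  qed
  moreover have ?T if P: ?P
    unfolding T_condition_def
  proof (intro ballI allI)
    fix \<kappa> p y h i j k
    assume Q: "\<kappa> \<in> \<A>" "p \<in> fst \<kappa>" and y: "y \<in> ab_dom_star J (a \<kappa> p) (b \<kappa> p)"
    interpret Q: ab_regular "a \<kappa> p" "b \<kappa> p" J \<phi> f1 f2 f3 f4 b0 by (rule reg[OF Q])
    obtain c c3 where P: "\<And>y. y \<in> ab_dom_star J (a \<kappa> p) (b \<kappa> p) \<Longrightarrow> ab_s (a \<kappa> p) (b \<kappa> p) y > 0 \<Longrightarrow>
        c * Q.M (ab_s (a \<kappa> p) (b \<kappa> p) y) > 0 \<and>
        \<phi> (ab_s (a \<kappa> p) (b \<kappa> p) y) = c3 * Q.profile c (ab_s (a \<kappa> p) (b \<kappa> p) y)"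
      using P Q unfolding Let_def Q.M_def Q.profile_def right_diff_distrib mult.assoc by blast
    \<comment> \<open>Every number in the interval is attained by \<open>s\<close>, which turns the
      hypothesis on vectors into one on numbers.\<close>
    have t: "c * Q.M t > 0 \<and> \<phi> t = c3 * Q.profile c t" if "t \<in> {0<..<Q.rad}" for t
    proof -
      have "t \<in> Q.I" using that Q.pos_part by blast
      then obtain y where "ab_s (a \<kappa> p) (b \<kappa> p) y = t" "y \<in> ab_dom_star J (a \<kappa> p) (b \<kappa> p)"
        using Q.I_attained by blast
      then show ?thesis using P[of y] that by simp
    qed
    \<comment> \<open>Positivity of \<open>c * M\<close> at a single value, here the midpoint,
      determines the sign of \<open>c\<close>.\<close>
    have "Q.rad / 2 \<in> {0<..<Q.rad}" using Q.rad_pos by simp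
    then have "c * Q.M (Q.rad / 2) > 0" "Q.M (Q.rad / 2) > 0"
      using t Q.M_pos Q.pos_part by blast+
    then have "c > 0" by (simp add: zero_less_mult_iff)
    have "Q.solves c {0<..<Q.rad}"
      by (rule Q.profile_imp_solves[OF \<open>c > 0\<close>]) (use t in blast)
    with \<open>c > 0\<close> show "T_tensor Q.F h i j k y = 0"
      by (intro Q.solves_imp_T_zero[OF _ _ y]) simp_all
  qed
  ultimately show ?thesis by blast
qed

end
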